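(* Let $n\ge 1$ and let $P\subset\mathbb{R}^2$ be a convex $(n+3)$-gon with no two vertices on the same vertical line. Let $\{y_I\}_{\varnothing\ne I\subseteq[n+1]}$ be the dilation factors in the Minkowski decomposition $\mathsf{Asso}(P)=\sum_{\varnothing\neq I\subseteq[n+1]}y_I\,\triangle_I$ of the associahedron $\mathsf{Asso}(P)$. Then for every non-empty $I\subseteq[n+1]$, $$y_I=\begin{cases}0 & \text{if } I \text{ is not a big top},\\ \Omega(I)+n+2 & \text{if } I=\{u\}\text{ with }u\in U,\\ \Omega(I) & \text{otherwise.}\end{cases}$$
   Context: Vertices of $P$: label the vertices of $P$ by $0,1,\dots,n+2$ in order of increasing $x$-coordinate. Write $[n+1]=\{1,\dots,n+1\}$. Let $U\subseteq[n+1]$ (up labels) and $D\subseteq[n+1]$ (down labels) be the sets of labels of the vertices among $1,\dots,n+1$ lying on the upper hull and on the lower hull of $P$, respectively (so $[n+1]=U\sqcup D$; the vertices $0$ and $n+2$ are neither up nor down). Diagonals: a diagonal of $P$ is a segment joining two vertices of $P$ (internal or a boundary edge). A dissection of $P$ is a set of pairwise non-crossing internal diagonals, which decomposes $P$ into polygonal cells; a triangulation is an inclusion-maximal dissection. For a diagonal $\delta$ (internal or not), $\mathsf{A}(\delta)\subseteq[n+1]$ is the set of labels $j\in[n+1]$ of the vertices lying strictly above the line supporting $\delta$, together with the labels of those endpoints of $\delta$ that are down vertices (endpoints that are up are excluded), and $\mathsf{B}(\delta)\subseteq[n+1]$ is the set of labels $j\in[n+1]$ of the vertices lying strictly below that line,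 together with the labels of those endpoints of $\delta$ that are up vertices (endpoints that are down are excluded). The labels $0,n+2$ are never included. Put $\mathsf{a}(\delta)=|\mathsf{A}(\delta)|$. The associahedron $\mathsf{Asso}(P)\subset\mathbb{R}^{n+1}$ is the polytope $$\mathsf{Asso}(P)=\Big\{\mathbf{x}\in\mathbb{R}^{n+1}:\ \sum_{j\in[n+1]}x_j=\binom{n+2}{2}\ \text{ and }\ \sum_{j\in \mathsf{B}(\delta)}x_j\ge\binom{|\mathsf{B}(\delta)|+1}{2}\ \text{ for all internal diagonals }\delta\text{ of }P\Big\}.$$ (It is also the convex hull of the points $\mathbf{x}(T)$, $T$ a triangulation of $P$, where $\mathbf{x}(T)$ is the unique point of the hyperplane $\sum_{j\in[n+1]} x_j=\binom{n+2}{2}$ at which the inequalities of all $\delta\in T$ are equalities.) Minkowski decomposition: for $\varnothing\ne I\subseteq[n+1]$, $\triangle_I=\mathrm{conv}\{e_i: i\in I\}$, with $e_1,\dots,e_{n+1}$ the standard basis of $\mathbb{R}^{n+1}$. A signed Minkowski sum $\sum_I y_I\triangle_I$ is understood with Minkowski differences: $Q-Q'$ is the unique polytope $R$ with $Q=Q'+R$, if it exists. Equivalently, put $z_J=\min_{\mathbf{x}\in\mathsf{Asso}(P)}\sum_{j\in J}x_j$ for $\varnothing\ne J\subseteq[n+1]$ (the tight right-hand sides). The dilation factors are the unique real numbers $y_I$ with $z_J=\sum_{\varnothing\ne I\subseteq J}y_I$ for all non-empty $J$, that is, $y_I=\sum_{\varnothing\ne J\subseteq I}(-1)^{|I\setminus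 J|}z_J$. Big tops: a two-dimensional polygonal cell $C$ of a dissection of $P$ (that is, the convex hull of at least three vertices of $P$) is a big top if its lower convex hull is contained in the lower hull of $P$. The intermediate vertices of $C$ are all its vertices except its leftmost and rightmost ones. A set $I\subseteq[n+1]$ is a big top if it is the set of labels of the intermediate vertices of a big top cell; this cell is then unique and denoted $C_I$. Weights: let $\delta_\ell(C)$ (resp. $\delta_r(C)$) be the edge of $C$ connecting its two leftmost (resp. two rightmost) vertices. Define $\ell(C)=-1$ if $\delta_\ell(C)$ is on the lower hull of $C$, and $\ell(C)=\mathsf{a}(\delta_\ell(C))+1$ otherwise. Similarly define $r(C)=-1$ if $\delta_r(C)$ is on the lower hull of $C$, and $r(C)=\mathsf{a}(\delta_r(C))+1$ otherwise. The weight of $C$ is $\Omega(C)=(-1)^{|C\cap U|}\,\ell(C)\,r(C)$, where $|C\cap U|$ is the number of vertices of $C$ with label in $U$. For a big top $I$, $\Omega(I)=\Omega(C_I)$. *)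

theory Defs
  imports "HOL-Analysis.Analysis" "HOL-Analysis.Finite_Function_Topology"
begin

section \<open>Polygons with labelled vertices\<close>

definition polygon :: "nat \<Rightarrow> (nat \<Rightarrow> real \<times> real) \<Rightarrow> (real \<times> real) set" where
  "polygon n p = convex hull (p ` {..n + 2})"

text \<open>The vertices \<open>p 0, \<dots>, p (n + 2)\<close> are listed by strictly increasing x-coordinate, so that
  no two of them lie on a vertical line, and each of them is a genuine corner.\<close>

definition convex_polygon :: "nat \<Rightarrow> (nat \<Rightarrow> real \<times> real) \<Rightarrow> bool" where
  "convex_polygon n p \<longleftrightarrow>
     strict_mono_on {..n + 2} (\<lambda>i. fst (p i)) \<and>
     (\<forall>i\<le>n + 2. p i extreme_point_of polygon n p)"

definition upper_hull :: "(real \<times> real) set \<Rightarrow> (real \<times> real) set" where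
  "upper_hull S = {v \<in> S. \<forall>w\<in>S. fst w = fst v \<longrightarrow> snd w \<le> snd v}"

definition lower_hull :: "(real \<times> real) set \<Rightarrow> (real \<times> real) set" where
  "lower_hull S = {v \<in> S. \<forall>w\<in>S. fst w = fst v \<longrightarrow> snd v \<le> snd w}"

definition up_labels :: "nat \<Rightarrow> (nat \<Rightarrow> real \<times> real) \<Rightarrow> nat set" where
  "up_labels n p = {j \<in> {1..n + 1}. p j \<in> upper_hull (polygon n p)}"

definition down_labels :: "nat \<Rightarrow> (nat \<Rightarrow> real \<times> real) \<Rightarrow> nat set" where
  "down_labels n p = {j \<in> {1..n + 1}. p j \<in> lower_hull (polygon n p)}"

section \<open>Diagonals\<close>

text \<open>The diagonal joining the vertices \<open>p i\<close> and \<open>p j\<close> is given by its labels \<open>i < j\<close>.\<close>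

definition internal_diagonal :: "nat \<Rightarrow> (nat \<Rightarrow> real \<times> real) \<Rightarrow> nat \<Rightarrow> nat \<Rightarrow> bool" where
  "internal_diagonal n p i j \<longleftrightarrow>
     i < j \<and> j \<le> n + 2 \<and> open_segment (p i) (p j) \<subseteq> interior (polygon n p)"

text \<open>The height at abscissa \<open>x\<close> of the (non-vertical) line through \<open>a\<close> and \<open>b\<close>.\<close>

definition line_height :: "real \<times> real \<Rightarrow> real \<times> real \<Rightarrow> real \<Rightarrow> real" where
  "line_height a b x = snd a + (snd b - snd a) / (fst b - fst a) * (x - fst a)"

definition A_set :: "nat \<Rightarrow> (nat \<Rightarrow> real \<times> real) \<Rightarrow> nat \<Rightarrow> nat \<Rightarrow> nat set" where
  "A_set n p i j =
     {k \<in> {1..n + 1}. line_height (p i) (p j) (fst (p k)) < snd (p k)} \<union> ({i, j} \<inter> down_labels n p)"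

definition B_set :: "nat \<Rightarrow> (nat \<Rightarrow> real \<times> real) \<Rightarrow> nat \<Rightarrow> nat \<Rightarrow> nat set" where
  "B_set n p i j =
     {k \<in> {1..n + 1}. snd (p k) < line_height (p i) (p j) (fst (p k))} \<union> ({i, j} \<inter> up_labels n p)"

section \<open>The associahedron and its Minkowski decomposition\<close>

text \<open>The space of dimension \<open>n + 1\<close> with coordinates labelled by \<open>{1..n + 1}\<close> is the space of the
  finitely supported real sequences \<^typ>\<open>nat \<Rightarrow>\<^sub>0 real\<close> whose support is contained in \<open>{1..n + 1}\<close>.\<close>

definition asso :: "nat \<Rightarrow> (nat \<Rightarrow> real \<times> real) \<Rightarrow> (nat \<Rightarrow>\<^sub>0 real) set" where
  "asso n p = {x.
     Poly_Mapping.keys x \<subseteq> {1..n + 1} \<and>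
     (\<Sum>j\<in>{1..n + 1}. Poly_Mapping.lookup x j) = real ((n + 2) choose 2) \<and>
     (\<forall>i j. internal_diagonal n p i j \<longrightarrow>
        (\<Sum>k\<in>B_set n p i j. Poly_Mapping.lookup x k) \<ge> real ((card (B_set n p i j) + 1) choose 2))}"

definition simplex_face :: "nat set \<Rightarrow> (nat \<Rightarrow>\<^sub>0 real) set" where
  "simplex_face I = convex hull ((\<lambda>i. Poly_Mapping.single i 1) ` I)"

text \<open>\<open>Q\<close> is the signed Minkowski sum of the \<open>y I *\<^sub>R simplex_face I\<close>. The summands with negative
  coefficients are moved to the other side; sums of sets are Minkowski sums.\<close>

definition minkowski_decomposition ::
    "nat \<Rightarrow> (nat \<Rightarrow>\<^sub>0 real) set \<Rightarrow> (nat set \<Rightarrow> real) \<Rightarrow> bool" where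
  "minkowski_decomposition n Q y \<longleftrightarrow>
     Q + (\<Sum>I | I \<noteq> {} \<and> I \<subseteq> {1..n + 1} \<and> y I < 0. (*\<^sub>R) (- y I) ` simplex_face I) =
     (\<Sum>I | I \<noteq> {} \<and> I \<subseteq> {1..n + 1} \<and> y I > 0. (*\<^sub>R) (y I) ` simplex_face I)"

text \<open>The tight right-hand side of \<open>Q\<close> for \<open>J\<close>, a minimum of values.\<close>

definition tight_rhs :: "(nat \<Rightarrow>\<^sub>0 real) set \<Rightarrow> nat set \<Rightarrow> real" where
  "tight_rhs Q J = (LEAST z. z \<in> (\<lambda>x. \<Sum>j\<in>J. Poly_Mapping.lookup x j) ` Q)"

definition dilation_factor :: "(nat \<Rightarrow>\<^sub>0 real) set \<Rightarrow> nat set \<Rightarrow> real" where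
  "dilation_factor Q I = (\<Sum>J | J \<noteq> {} \<and> J \<subseteq> I. (- 1) ^ card (I - J) * tight_rhs Q J)"

section \<open>Big tops and their weights\<close>

text \<open>A polygonal cell is given by its set \<open>S\<close> of vertex labels. Since labels increase with the
  x-coordinate, \<open>Min S\<close> and \<open>Max S\<close> are its leftmost and rightmost vertices.\<close>

definition cell :: "nat \<Rightarrow> nat set \<Rightarrow> bool" where
  "cell n S \<longleftrightarrow> S \<subseteq> {..n + 2} \<and> card S \<ge> 3"

definition intermediate :: "nat set \<Rightarrow> nat set" where
  "intermediate S = S - {Min S, Max S}"

definition big_top_cell :: "nat \<Rightarrow> (nat \<Rightarrow> real \<times> real) \<Rightarrow> nat set \<Rightarrow> bool" where
  "big_top_cell n p S \<longleftrightarrow>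
     cell n S \<and> lower_hull (convex hull (p ` S)) \<subseteq> lower_hull (polygon n p)"

definition big_top :: "nat \<Rightarrow> (nat \<Rightarrow> real \<times> real) \<Rightarrow> nat set \<Rightarrow> bool" where
  "big_top n p I \<longleftrightarrow> (\<exists>S. big_top_cell n p S \<and> intermediate S = I)"

text \<open>For a big top \<open>I \<noteq> {}\<close> the cell is unique.\<close>

definition big_top_cell_of :: "nat \<Rightarrow> (nat \<Rightarrow> real \<times> real) \<Rightarrow> nat set \<Rightarrow> nat set" where
  "big_top_cell_of n p I = (THE S. big_top_cell n p S \<and> intermediate S = I)"

text \<open>The factor contributed by the edge \<open>(i, j)\<close> of the cell \<open>S\<close>.\<close>

definition edge_factor :: "nat \<Rightarrow> (nat \<Rightarrow> real \<times> real) \<Rightarrow> nat set \<Rightarrow> nat \<Rightarrow> nat \<Rightarrow> int" where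
  "edge_factor n p S i j =
     (if closed_segment (p i) (p j) \<subseteq> lower_hull (convex hull (p ` S)) then - 1
      else int (card (A_set n p i j)) + 1)"

definition left_factor :: "nat \<Rightarrow> (nat \<Rightarrow> real \<times> real) \<Rightarrow> nat set \<Rightarrow> int" where
  "left_factor n p S = edge_factor n p S (Min S) (Min (S - {Min S}))"

definition right_factor :: "nat \<Rightarrow> (nat \<Rightarrow> real \<times> real) \<Rightarrow> nat set \<Rightarrow> int" where
  "right_factor n p S = edge_factor n p S (Max (S - {Max S})) (Max S)"

definition cell_weight :: "nat \<Rightarrow> (nat \<Rightarrow> real \<times> real) \<Rightarrow> nat set \<Rightarrow> int" where
  "cell_weight n p S =
     (- 1) ^ card (S \<inter> up_labels n p) * left_factor n p S * right_factor n p S"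

definition big_top_weight :: "nat \<Rightarrow> (nat \<Rightarrow> real \<times> real) \<Rightarrow> nat set \<Rightarrow> int" where
  "big_top_weight n p I = cell_weight n p (big_top_cell_of n p I)"

end

theory Submission
  imports Defs
begin

text \<open>
  A set \<open>J\<close> of labels determines an x-monotone path from the vertex \<open>0\<close> to the vertex \<open>n + 2\<close>: it
  bends at the down vertices outside \<open>J\<close> and at the up vertices inside \<open>J\<close>. With the endpoint
  convention of \<open>B_set\<close>, the set \<open>J\<close> is what lies below this path. For an edge \<open>\<delta> = (i, j)\<close> the
  indicator function of \<open>B(\<delta>)\<close> is a term that depends only on \<open>i\<close> plus a term that depends only on \<open>j\<close>
  (\<open>sum_below\<close>). Summed over the edges of the path, these terms regroup by vertices and give
  \<open>\<Sum>\<^sub>\<delta> 1\<^bsub>B(\<delta>)\<^esub> = 1\<^sub>J + \<bar>U \<inter> J\<bar> \<cdot> 1\<close> (\<open>sum_path\<close>). Adding up the inequalities of the edges thus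
  bounds \<open>\<Sum>\<^bsub>j \<in> J\<^esub> x\<^sub>j\<close> from below on the associahedron by
  \<open>((n + 2) \<bar>J\<bar> - \<Sum>\<^sub>\<delta> a(\<delta>) b(\<delta>)) / 2\<close>, where \<open>b = \<bar>B\<bar>\<close> and \<open>a = n + 1 - b\<close>. This is \<open>path_rhs J\<close>.

  The bound is attained. Inserting a label into \<open>J\<close> changes the path only next to that label, and
  changes \<open>path_rhs J\<close> by an expression in the product of two differences, one for each neighbour on
  the path; monotonicity of the two factors makes \<open>path_rhs\<close> supermodular (\<open>path_rhs_supermodular\<close>).
  The greedy algorithm then yields a point on which the coordinate sum over \<open>J\<close> is \<open>path_rhs J\<close> and
  over every other set \<open>K\<close> is at least \<open>path_rhs K\<close>. On the sets \<open>B(\<delta>)\<close> the function \<open>path_rhs\<close> is the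
  right-hand side in the definition of the associahedron (\<open>path_rhs_below\<close>), so this point belongs to
  the associahedron, and \<open>path_rhs\<close> gives its tight right-hand sides (\<open>tight_rhs_asso\<close>).

  It remains to invert \<open>path_rhs\<close>. Whether \<open>(i, j)\<close> is an edge of the path of \<open>J\<close> depends only on
  the labels of \<open>J\<close> between \<open>i\<close> and \<open>j\<close>. The alternating sum over all \<open>J \<subseteq> I\<close> therefore cancels every
  edge that does not span \<open>I\<close>, and the survivors join \<open>a\<close> or \<open>Min I\<close> to \<open>Max I\<close> or \<open>b\<close>, where \<open>a\<close>
  and \<open>b\<close> are the vertices of the lower hull next to \<open>I\<close>. They survive only if \<open>I\<close> contains all down
  labels between \<open>Min I\<close> and \<open>Max I\<close>, and this says that \<open>I\<close> is a big top with cell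
  \<open>{a} \<union> I \<union> {b}\<close>. The edge costs are a quadratic function of an additive quantity, so the signed sum of
  the four of them is a product, whose factors are the two edge factors of the cell. For
  \<open>I = {k}\<close> the degenerate edge \<open>(k, k)\<close> is missing; its formal cost \<open>- (n + 2)\<close> cancels the inverse
  of the linear part \<open>(n + 2) \<bar>J\<bar> / 2\<close> if \<open>k\<close> is down and doubles it if \<open>k\<close> is up, which explains
  the summand \<open>n + 2\<close>.

  Finally, minima of coordinate sums add under Minkowski addition, and the minimum over \<open>J\<close> on a
  simplex face of \<open>I\<close> is \<open>1\<close> or \<open>0\<close> according to \<open>I \<subseteq> J\<close>. So the coefficients of any signed Minkowski
  decomposition are obtained from the tight right-hand sides by the same inversion.
\<close>

section \<open>Alternating sums over Boolean intervals\<close>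

text \<open>The sets between \<open>A\<close> and \<open>I - C\<close> form a Boolean lattice, whose even and odd members are equally
  many unless it is a single point.\<close>

lemma sum_alternating_interval:
  fixes I A C :: "'a set"
  assumes "finite I" "A \<inter> C = {}"
  shows "(\<Sum>J | J \<subseteq> I \<and> A \<subseteq> J \<and> J \<inter> C = {}. (- 1) ^ card (I - J)) =
    (if A \<subseteq> I \<and> I \<subseteq> A \<union> C then (- 1) ^ card (I - A) else (0::real))"
proof (cases "A \<subseteq> I")
  case False
  then have empty: "{J. J \<subseteq> I \<and> A \<subseteq> J \<and> J \<inter> C = {}} = {}"
    by auto
  show ?thesis
    unfolding empty using False by simp
next
  case True
  let ?S = "{J. J \<subseteq> I \<and> A \<subseteq> J \<and> J \<inter> C = {}}"
  have S: "?S = {J. J \<subseteq> I - C \<and> A \<subseteq> J}"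
    by auto
  show ?thesis
  proof (cases "I \<subseteq> A \<union> C")
    case I: True
    then have "?S = {A}"
      using True assms(2) by auto
    then show ?thesis
      using True I by simp
  next
    case False
    have "A \<subset> I - C"
      using True False assms(2) by auto
    then have "card {J. J \<subseteq> I - C \<and> A \<subseteq> J \<and> even (card J)} =
        card {J. J \<subseteq> I - C \<and> A \<subseteq> J \<and> odd (card J)}"
      by (intro card_subsupersets_even_odd) (use assms in auto)
    then have 0: "(\<Sum>J\<in>?S. (- 1) ^ card J) = (0::real)"
      unfolding S by (intro sum_alternating_cancels) (use assms in \<open>auto simp: conj_assoc\<close>)
    have "(\<Sum>J\<in>?S. (- 1) ^ card (I - J)) = (\<Sum>J\<in>?S. (- 1) ^ card I * (- 1) ^ card J :: real)"
    proof (rule sum.cong[OF refl])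
      fix J assume "J \<in> ?S"
      then have "card I = card (I - J) + card J" and "finite J"
        using assms(1) by (auto simp: card_Diff_subset card_mono finite_subset)
      then show "(- 1) ^ card (I - J) = ((- 1) ^ card I * (- 1) ^ card J :: real)"
        by (simp add: power_add mult.assoc flip: power_mult_distrib)
    qed
    then show ?thesis
      using 0 False by (simp flip: sum_distrib_left)
  qed
qed

lemma moebius_inversion:
  fixes z y :: "'a set \<Rightarrow> real"
  assumes "finite I" "I \<noteq> {}"
    and z: "\<And>J. J \<noteq> {} \<Longrightarrow> J \<subseteq> I \<Longrightarrow> z J = (\<Sum>K | K \<noteq> {} \<and> K \<subseteq> J. y K)"
  shows "(\<Sum>J | J \<noteq> {} \<and> J \<subseteq> I. (- 1) ^ card (I - J) * z J) = y I"
proof -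
  let ?s = "\<lambda>J. (- 1) ^ card (I - J) :: real" and ?S = "{K. K \<noteq> {} \<and> K \<subseteq> I}"
  have fin: "finite ?S"
    using assms(1) by simp
  have "(\<Sum>J\<in>?S. ?s J * z J) = (\<Sum>J\<in>?S. \<Sum>K\<in>?S. if K \<subseteq> J then ?s J * y K else 0)"
  proof (rule sum.cong[OF refl])
    fix J assume J: "J \<in> ?S"
    have "(\<Sum>K\<in>?S. if K \<subseteq> J then ?s J * y K else 0) = (\<Sum>K | K \<noteq> {} \<and> K \<subseteq> J. ?s J * y K)"
      using fin J by (intro sum.mono_neutral_cong_right) auto
    then show "?s J * z J = (\<Sum>K\<in>?S. if K \<subseteq> J then ?s J * y K else 0)"
      using z[of J] J by (simp add: sum_distrib_left)
  qed
  also have "\<dots> = (\<Sum>K\<in>?S. \<Sum>J\<in>?S. if K \<subseteq> J then ?s J * y K else 0)"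
    by (rule sum.swap)
  also have "\<dots> = (\<Sum>K\<in>?S. if K = I then y I else 0)"
  proof (rule sum.cong[OF refl])
    fix K assume K: "K \<in> ?S"
    have "(\<Sum>J\<in>?S. if K \<subseteq> J then ?s J * y K else 0) =
        (\<Sum>J | J \<subseteq> I \<and> K \<subseteq> J \<and> J \<inter> {} = {}. ?s J * y K)"
      using fin K by (intro sum.mono_neutral_cong_right) auto
    also have "\<dots> = (if K = I then y I else 0)"
      unfolding sum_distrib_right[symmetric] sum_alternating_interval[OF assms(1) Int_empty_right]
      using K by auto
    finally show "(\<Sum>J\<in>?S. if K \<subseteq> J then ?s J * y K else 0) = (if K = I then y I else 0)" .
  qed
  also have "\<dots> = y I"
    using fin assms(2) by simp
  finally show ?thesis .
qed

lemma minus_one_card_sym_diff: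
  fixes A X :: "'b set"
  assumes "finite A" "finite X"
  shows "(- 1) ^ card ((A - X) \<union> (X - A)) = ((- 1) ^ card A * (- 1) ^ card X :: real)"
proof -
  have "card A = card (A - X) + card (A \<inter> X)" "card X = card (X - A) + card (A \<inter> X)"
    using assms by (metis card_Diff_subset_Int card_mono finite_Int inf_le1 le_add_diff_inverse2 inf_commute)+
  moreover have "card ((A - X) \<union> (X - A)) = card (A - X) + card (X - A)"
    using assms by (intro card_Un_disjoint) auto
  ultimately show ?thesis
    by (simp add: power_add minus_one_power_iff)
qed

section \<open>Edges of a path through a finite set of labels\<close>

definition path_edges :: "nat set \<Rightarrow> (nat \<times> nat) set" where
  "path_edges V = {(i, j). i \<in> V \<and> j \<in> V \<and> i < j \<and> V \<inter> {i<..<j} = {}}"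

lemma finite_path_edges: "finite V \<Longrightarrow> finite (path_edges V)"
  by (rule finite_subset[of _ "V \<times> V"]) (auto simp: path_edges_def)

lemma edge_across:
  assumes "finite V" "k \<notin> V" "v \<in> V" "v < k" "w \<in> V" "k < w"
  obtains i j where "(i, j) \<in> path_edges V" "i < k" "k < j"
proof
  let ?i = "Max {u \<in> V. u < k}" and ?j = "Min {u \<in> V. k < u}"
  have i: "?i \<in> {u \<in> V. u < k}"
    using assms by (intro Max_in) auto
  have j: "?j \<in> {u \<in> V. k < u}"
    using assms by (intro Min_in) auto
  show "?i < k" "k < ?j"
    using i j by auto
  have "u \<le> ?i \<or> ?j \<le> u" if "u \<in> V" for u
    using that assms by (cases u k rule: linorder_cases) auto
  then show "(?i, ?j) \<in> path_edges V"
    using i j unfolding path_edges_def by fastforce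
qed

lemma sum_path_edges_insert:
  fixes g :: "nat \<Rightarrow> nat \<Rightarrow> real"
  assumes "finite V" "(i, j) \<in> path_edges V" "i < k" "k < j"
  shows "(\<Sum>(i, j)\<in>path_edges (insert k V). g i j) =
    (\<Sum>(i, j)\<in>path_edges V. g i j) - g i j + g i k + g k j"
proof -
  have V: "i \<in> V" "j \<in> V" "V \<inter> {i<..<j} = {}"
    using assms(2) by (auto simp: path_edges_def)
  have "k \<notin> V"
    using assms V by auto
  have gap: "u \<le> i \<or> j \<le> u" if "u \<in> V" for u
    using V that by force
  have E: "path_edges (insert k V) =
      insert (i, k) (insert (k, j) (path_edges V - {(i, j)}))" (is "?L = ?R")
  proof (intro subset_antisym subrelI)
    fix a b assume ab: "(a, b) \<in> ?L"
    then have ab': "a \<in> insert k V" "b \<in> insert k V" "a < b"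
      and free: "\<And>u. u \<in> insert k V \<Longrightarrow> u \<le> a \<or> b \<le> u"
      by (force simp: path_edges_def)+
    show "(a, b) \<in> ?R"
    proof (cases "a = k \<or> b = k")
      case True
      then show ?thesis
        using free[of i] free[of j] ab' V gap[of a] gap[of b] assms \<open>k \<notin> V\<close> by auto
    next
      case False
      moreover have "(a, b) \<noteq> (i, j)"
        using free[of k] assms by auto
      ultimately show ?thesis
        using ab by (auto simp: path_edges_def)
    qed
  next
    fix a b assume "(a, b) \<in> ?R"
    then consider "a = i \<and> b = k" | "a = k \<and> b = j" | "(a, b) \<in> path_edges V" "(a, b) \<noteq> (i, j)"
      by auto
    then show "(a, b) \<in> ?L"
    proof cases
      case 1
      then show ?thesis
        using assms V by (auto simp: path_edges_def)
    next
      case 2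
      then show ?thesis
        using assms V by (auto simp: path_edges_def)
    next
      case 3
      then have ab: "a \<in> V" "b \<in> V" "a < b" and free: "\<And>u. u \<in> V \<Longrightarrow> u \<le> a \<or> b \<le> u"
        by (force simp: path_edges_def)+
      have "k \<le> a \<or> b \<le> k"
        using 3(2) free[OF V(1)] free[OF V(2)] gap[OF ab(1)] gap[OF ab(2)] assms(3,4) ab(3) by auto
      then show ?thesis
        using ab free by (force simp: path_edges_def)
    qed
  qed
  have new: "(i, k) \<notin> path_edges V" "(k, j) \<notin> path_edges V" "(i, k) \<noteq> (k, j)"
    using \<open>k \<notin> V\<close> assms by (auto simp: path_edges_def)
  show ?thesis
    unfolding E using new assms finite_path_edges[OF assms(1)]
    by (simp add: sum_diff1)
qed

text \<open>Every inner vertex is the right end of one edge and the left end of another.\<close>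

lemma sum_path_edges_additive:
  fixes g h :: "nat \<Rightarrow> real"
  assumes "W \<subseteq> {0<..<N}" "0 < N"
  shows "(\<Sum>(i, j)\<in>path_edges ({0, N} \<union> W). g i + h j) = g 0 + h N + (\<Sum>k\<in>W. g k + h k)"
proof -
  have "finite W"
    using assms finite_subset by blast
  then show ?thesis
    using assms
  proof (induction W rule: finite_induct)
    case empty
    have "path_edges {0, N} = {(0, N)}"
      using empty by (auto simp: path_edges_def)
    then show ?case
      by simp
  next
    case (insert k W)
    have "k \<notin> {0, N} \<union> W"
      using insert by auto
    then obtain i j where ij: "(i, j) \<in> path_edges ({0, N} \<union> W)" "i < k" "k < j"
      using edge_across[of "{0, N} \<union> W" k 0 N] insert by auto
    have "{0, N} \<union> insert k W = insert k ({0, N} \<union> W)"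
      by auto
    then show ?case
      using sum_path_edges_insert[OF _ ij, of "\<lambda>i j. g i + h j"] insert by simp
  qed
qed

section \<open>The greedy point of a supermodular function\<close>

text \<open>Label by label, the greedy rule gives each new element its marginal value; supermodularity keeps
  all the lower bounds valid. Processing \<open>J\<close> before the rest of \<open>E\<close> makes the bound for \<open>J\<close> tight.\<close>

lemma supermodular_greedy:
  fixes f :: "'a set \<Rightarrow> real"
  assumes "finite E" "J \<subseteq> E" "f {} = 0"
    and marginal: "\<And>Q P e. Q \<subseteq> P \<Longrightarrow> P \<subseteq> E \<Longrightarrow> e \<in> E - P \<Longrightarrow>
      f (insert e Q) - f Q \<le> f (insert e P) - f P"
  obtains x where "sum x E = f E" "sum x J = f J" "\<And>K. K \<subseteq> E \<Longrightarrow> f K \<le> sum x K"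
proof -
  have extend: "\<exists>x. (\<forall>k\<in>P. x k = x0 k) \<and> sum x (P \<union> R) = f (P \<union> R) \<and>
      (\<forall>K\<subseteq>P \<union> R. f K \<le> sum x K)"
    if "P \<union> R \<subseteq> E" "P \<inter> R = {}" "sum x0 P = f P" "\<forall>K\<subseteq>P. f K \<le> sum x0 K" for x0 P R
  proof -
    have "finite R"
      using that assms finite_subset by blast
    then show ?thesis
      using that
    proof (induction R rule: finite_induct)
      case empty
      then show ?case
        by auto
    next
      case (insert e R)
      then obtain x where x: "\<forall>k\<in>P. x k = x0 k" "sum x (P \<union> R) = f (P \<union> R)"
        "\<And>K. K \<subseteq> P \<union> R \<Longrightarrow> f K \<le> sum x K"
        by auto
      let ?Q = "P \<union> R"
      define y where "y = x(e := f (insert e ?Q) - f ?Q)"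
      have e: "e \<notin> ?Q" "finite ?Q" "?Q \<subseteq> E" "e \<in> E"
        using insert assms(1) by (auto intro: finite_subset)
      have y: "sum y K = sum x K" if "e \<notin> K" for K
        using that by (auto simp: y_def intro: sum.cong)
      have "f K \<le> sum y K" if K: "K \<subseteq> insert e ?Q" for K
      proof (cases "e \<in> K")
        case True
        have K': "K - {e} \<subseteq> ?Q" "finite K" "insert e (K - {e}) = K"
          using K True e by (auto intro: finite_subset)
        have "f K - f (K - {e}) \<le> f (insert e ?Q) - f ?Q"
          using marginal[OF K'(1) e(3), of e] e K'(3) by simp
        moreover have "sum y K = y e + sum x (K - {e})"
          using y[of "K - {e}"] sum.remove[OF K'(2) True, of y] by simp
        ultimately show ?thesis
          using x(3)[OF K'(1)] by (simp add: y_def)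
      next
        case False
        then show ?thesis
          using K x(3)[of K] y[of K] by auto
      qed
      moreover have "sum y (insert e ?Q) = f (insert e ?Q)"
        using e y[OF e(1)] x(2) by (simp add: y_def)
      moreover have "\<forall>k\<in>P. y k = x0 k"
        using x(1) e by (auto simp: y_def)
      moreover have "P \<union> insert e R = insert e ?Q"
        by auto
      ultimately show ?case
        by (intro exI[of _ y]) auto
    qed
  qed
  obtain x0 where x0: "sum x0 J = f J" "\<forall>K\<subseteq>J. f K \<le> sum x0 K"
    using extend[of "{}" J "\<lambda>_. 0"] assms by auto
  have "J \<union> (E - J) = E"
    using assms by auto
  then obtain x where x: "\<forall>k\<in>J. x k = x0 k" "sum x E = f E" "\<forall>K\<subseteq>E. f K \<le> sum x K"
    using extend[of J "E - J" x0] x0 by auto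
  have "sum x J = sum x0 J"
    using x(1) by (auto intro: sum.cong)
  then show ?thesis
    using that x x0 by auto
qed

section \<open>Minima of coordinate sums on Minkowski sums\<close>

definition attains_min :: "('a \<Rightarrow> real) \<Rightarrow> 'a set \<Rightarrow> real \<Rightarrow> bool" where
  "attains_min \<phi> Q z \<longleftrightarrow> (\<exists>x\<in>Q. \<phi> x = z) \<and> (\<forall>x\<in>Q. z \<le> \<phi> x)"

lemma attains_min_unique: "attains_min \<phi> Q z \<Longrightarrow> attains_min \<phi> Q z' \<Longrightarrow> z = z'"
  unfolding attains_min_def by (metis order_antisym)

lemma attains_min_plus:
  fixes \<phi> :: "'a::ab_group_add \<Rightarrow> real"
  assumes "\<And>x y. \<phi> (x + y) = \<phi> x + \<phi> y" "attains_min \<phi> Q z" "attains_min \<phi> R w"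
  shows "attains_min \<phi> (Q + R) (z + w)"
proof -
  obtain x y where "x \<in> Q" "\<phi> x = z" "y \<in> R" "\<phi> y = w"
    using assms(2,3) by (auto simp: attains_min_def)
  then have "x + y \<in> Q + R" "\<phi> (x + y) = z + w"
    using assms(1) by auto
  moreover have "z + w \<le> \<phi> v" if v: "v \<in> Q + R" for v
  proof -
    obtain a b where "v = a + b" "a \<in> Q" "b \<in> R"
      using set_plus_elim[OF v] by blast
    then show ?thesis
      using assms by (simp add: attains_min_def add_mono)
  qed
  ultimately show ?thesis
    unfolding attains_min_def by blast
qed

lemma attains_min_sum:
  fixes \<phi> :: "'a::ab_group_add \<Rightarrow> real"
  assumes add: "\<And>x y. \<phi> (x + y) = \<phi> x + \<phi> y"
    and "finite A" "\<And>i. i \<in> A \<Longrightarrow> attains_min \<phi> (Q i) (z i)"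
  shows "attains_min \<phi> (\<Sum>i\<in>A. Q i) (\<Sum>i\<in>A. z i)"
  using assms(2,3)
proof (induction A rule: finite_induct)
  case empty
  have "\<phi> 0 = 0"
    using add[of 0 0] by simp
  then show ?case
    by (simp add: attains_min_def set_zero)
next
  case (insert i A)
  then show ?case
    using attains_min_plus[OF add] by simp
qed

abbreviation coordinate_sum :: "nat set \<Rightarrow> (nat \<Rightarrow>\<^sub>0 real) \<Rightarrow> real" where
  "coordinate_sum J x \<equiv> \<Sum>j\<in>J. Poly_Mapping.lookup x j"

lemma coordinate_sum_add: "coordinate_sum J (x + y) = coordinate_sum J x + coordinate_sum J y"
  by (simp add: lookup_add sum.distrib)

lemma coordinate_sum_scaleR: "coordinate_sum J (c *\<^sub>R x) = c * coordinate_sum J x"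
proof -
  have "finite {k. c *\<^sub>R Poly_Mapping.lookup x k \<noteq> 0}"
    by (rule finite_subset[OF _ finite_keys[of x]]) (auto simp: in_keys_iff)
  then have "Poly_Mapping.lookup (c *\<^sub>R x) = (\<lambda>k. c * Poly_Mapping.lookup x k)"
    unfolding scaleR_poly_mapping_def by (simp add: lookup_Abs_poly_mapping)
  then show ?thesis
    by (simp add: sum_distrib_left)
qed

lemma coordinate_sum_single:
  "finite J \<Longrightarrow> coordinate_sum J (Poly_Mapping.single i 1) = (if i \<in> J then 1 else 0)"
  by (simp add: lookup_single when_def)

lemma attains_min_simplex_face:
  assumes "I \<noteq> {}" "finite J" "0 \<le> c"
  shows "attains_min (coordinate_sum J) ((*\<^sub>R) c ` simplex_face I) (if I \<subseteq> J then c else 0)"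
proof -
  let ?m = "if I \<subseteq> J then 1 else 0 :: real" and ?e = "\<lambda>i. Poly_Mapping.single i (1::real)"
  have "convex {x. ?m \<le> coordinate_sum J x}"
    unfolding convex_def
  proof (intro ballI allI impI, simp only: mem_Collect_eq)
    fix x y :: "nat \<Rightarrow>\<^sub>0 real" and u v :: real
    assume *: "?m \<le> coordinate_sum J x" "?m \<le> coordinate_sum J y" "0 \<le> u" "0 \<le> v" "u + v = 1"
    then have "u * ?m + v * ?m \<le> u * coordinate_sum J x + v * coordinate_sum J y"
      by (intro add_mono mult_left_mono) auto
    moreover have "u * m + v * m = m" for m :: real
      using *(5) by (simp flip: distrib_right)
    ultimately show "?m \<le> coordinate_sum J (u *\<^sub>R x + v *\<^sub>R y)"
      unfolding coordinate_sum_add coordinate_sum_scaleR by metis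
  qed
  moreover have "?e ` I \<subseteq> {x. ?m \<le> coordinate_sum J x}"
    using coordinate_sum_single[OF assms(2)] by auto
  ultimately have lower: "simplex_face I \<subseteq> {x. ?m \<le> coordinate_sum J x}"
    unfolding simplex_face_def by (intro hull_minimal)
  obtain i where i: "i \<in> I" "i \<in> J \<longleftrightarrow> I \<subseteq> J"
    using assms(1) by blast
  then have "?e i \<in> simplex_face I" "coordinate_sum J (?e i) = ?m"
    using coordinate_sum_single[OF assms(2)] by (auto simp: simplex_face_def intro: hull_inc)
  then have attained: "\<exists>y\<in>(*\<^sub>R) c ` simplex_face I. coordinate_sum J y = c * ?m"
    by (intro bexI[of _ "c *\<^sub>R ?e i"] imageI) (simp_all only: coordinate_sum_scaleR)
  have bound: "\<forall>y\<in>(*\<^sub>R) c ` simplex_face I. c * ?m \<le> coordinate_sum J y"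
  proof
    fix y assume "y \<in> (*\<^sub>R) c ` simplex_face I"
    then obtain x where x: "x \<in> simplex_face I" "y = c *\<^sub>R x"
      by blast
    then have "c * ?m \<le> c * coordinate_sum J x"
      using lower assms(3) by (intro mult_left_mono) blast+
    then show "c * ?m \<le> coordinate_sum J y"
      unfolding x(2) coordinate_sum_scaleR .
  qed
  have "attains_min (coordinate_sum J) ((*\<^sub>R) c ` simplex_face I) (c * ?m)"
    unfolding attains_min_def using attained bound by (rule conjI)
  moreover have "c * ?m = (if I \<subseteq> J then c else 0)"
    by simp
  ultimately show ?thesis
    by (simp only:)
qed

text \<open>The minima of the two sides agree; the negative summands come back across this equation of numbers.\<close>

lemma minkowski_decomposition_min:
  assumes "minkowski_decomposition n Q y" and "J \<subseteq> {1..n + 1}"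
    and "attains_min (coordinate_sum J) Q z"
  shows "z = (\<Sum>I | I \<noteq> {} \<and> I \<subseteq> J. y I)"
proof -
  let ?S = "{I. I \<noteq> {} \<and> I \<subseteq> {1..n + 1}}"
  let ?N = "{I. I \<noteq> {} \<and> I \<subseteq> {1..n + 1} \<and> y I < 0}"
  let ?P = "{I. I \<noteq> {} \<and> I \<subseteq> {1..n + 1} \<and> y I > 0}"
  let ?m = "\<lambda>I. if I \<subseteq> J then y I else 0"
  have "finite J"
    using assms(2) by (rule finite_subset) simp
  have "?N \<subseteq> Pow {1..n + 1}" "?P \<subseteq> Pow {1..n + 1}" "?S \<subseteq> Pow {1..n + 1}"
    by auto
  then have fin: "finite ?N" "finite ?P" "finite ?S"
    by (simp_all add: finite_subset)
  have N: "attains_min (coordinate_sum J) (\<Sum>I\<in>?N. (*\<^sub>R) (- y I) ` simplex_face I)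
      (\<Sum>I\<in>?N. if I \<subseteq> J then - y I else 0)"
    using fin \<open>finite J\<close>
    by (intro attains_min_sum attains_min_simplex_face coordinate_sum_add) auto
  have P: "attains_min (coordinate_sum J) (\<Sum>I\<in>?P. (*\<^sub>R) (y I) ` simplex_face I) (\<Sum>I\<in>?P. ?m I)"
    using fin \<open>finite J\<close>
    by (intro attains_min_sum attains_min_simplex_face coordinate_sum_add) auto
  have "z + (\<Sum>I\<in>?N. if I \<subseteq> J then - y I else 0) = (\<Sum>I\<in>?P. ?m I)"
    using attains_min_plus[OF coordinate_sum_add assms(3) N] P assms(1)
    unfolding minkowski_decomposition_def by (auto intro: attains_min_unique)
  moreover have "(\<Sum>I\<in>?N. if I \<subseteq> J then - y I else 0) = - (\<Sum>I\<in>?N. ?m I)"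
    unfolding sum_negf[symmetric] by (intro sum.cong) auto
  moreover have "(\<Sum>I\<in>?N. ?m I) + (\<Sum>I\<in>?P. ?m I) = (\<Sum>I\<in>?N \<union> ?P. ?m I)"
    using fin by (intro sum.union_disjoint[symmetric]) auto
  moreover have "(\<Sum>I\<in>?N \<union> ?P. ?m I) = (\<Sum>I\<in>?S. ?m I)"
    using fin by (intro sum.mono_neutral_left) (auto simp: not_less le_less)
  moreover have "(\<Sum>I\<in>?S. ?m I) = (\<Sum>I | I \<noteq> {} \<and> I \<subseteq> J. y I)"
    using fin assms(2) by (intro sum.mono_neutral_cong_right) auto
  ultimately show ?thesis
    by simp
qed

section \<open>Up and down labels: the path of a label set\<close>

locale up_down_labels =
  fixes n :: nat and U D :: "nat set"
  assumes labels: "U \<union> D = {1..n + 1}" and disjoint: "U \<inter> D = {}"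
begin

lemma U_sub: "U \<subseteq> {1..n + 1}" and D_sub: "D \<subseteq> {1..n + 1}"
  using labels by auto

lemma up_or_down: "k \<in> {1..n + 1} \<Longrightarrow> k \<in> U \<or> k \<in> D"
  using labels by blast

lemma finite_UD: "finite U" "finite D"
  using U_sub D_sub finite_subset by blast+

lemma not_end: "0 \<notin> U" "0 \<notin> D" "n + 2 \<notin> U" "n + 2 \<notin> D"
  using U_sub D_sub by force+

text \<open>The set \<open>B(i, j)\<close> of the diagonal \<open>(i, j)\<close> in terms of labels only: by convexity, whether a vertex
  lies below the line is decided by the type of the middle one of the three vertices.\<close>

definition below :: "nat \<Rightarrow> nat \<Rightarrow> nat set" where
  "below i j = {k \<in> {1..n + 1}.
     k \<le> i \<and> i \<in> U \<or> i < k \<and> k < j \<and> k \<in> D \<or> j \<le> k \<and> j \<in> U}"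

lemma below_sub: "below i j \<subseteq> {1..n + 1}"
  by (auto simp: below_def)

lemma finite_below: "finite (below i j)"
  by (auto simp: below_def)

text \<open>The two halves of the additive splitting of the indicator function of \<open>below i j\<close>, weighted by \<open>x\<close>.
  Up vertices contribute the labels on the outer side of the edge, and the down labels strictly
  between \<open>i\<close> and \<open>j\<close> are a difference of two initial segments.\<close>

definition left_mass :: "(nat \<Rightarrow> real) \<Rightarrow> nat \<Rightarrow> real" where
  "left_mass x i = (if i \<in> U then sum x {1..i} else 0) - sum x (D \<inter> {..i})"

definition right_mass :: "(nat \<Rightarrow> real) \<Rightarrow> nat \<Rightarrow> real" where
  "right_mass x j = (if j \<in> U then sum x {j..n + 1} else 0) + sum x (D \<inter> {..<j})"

lemma sum_below:
  assumes "i < j" "j \<le> n + 2"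
  shows "sum x (below i j) = left_mass x i + right_mass x j"
proof -
  let ?l = "if i \<in> U then {1..i} else {}" and ?r = "if j \<in> U then {j..n + 1} else {}"
  have "below i j = ?l \<union> (D \<inter> {i<..<j}) \<union> ?r"
    using assms D_sub by (auto simp: below_def)
  moreover have "sum x \<dots> = sum x (?l \<union> (D \<inter> {i<..<j})) + sum x ?r"
    using assms finite_UD by (intro sum.union_disjoint) auto
  moreover have "sum x (?l \<union> (D \<inter> {i<..<j})) = sum x ?l + sum x (D \<inter> {i<..<j})"
    using assms finite_UD by (intro sum.union_disjoint) auto
  moreover have "D \<inter> {..<j} = D \<inter> {..i} \<union> D \<inter> {i<..<j}"
    using assms by auto
  moreover have "sum x \<dots> = sum x (D \<inter> {..i}) + sum x (D \<inter> {i<..<j})"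
    using assms finite_UD by (intro sum.union_disjoint) auto
  ultimately show ?thesis
    by (simp add: left_mass_def right_mass_def)
qed

lemma mass_up:
  assumes "k \<in> U"
  shows "left_mass x k + right_mass x k = sum x {1..n + 1} + x k"
proof -
  have k: "1 \<le> k" "k \<le> n + 1" "k \<notin> D"
    using assms U_sub disjoint by auto
  then have "D \<inter> {..k} = D \<inter> {..<k}"
    by (auto simp: le_less)
  moreover have "{1..n + 1} = {1..k} \<union> {k<..n + 1}" "{k..n + 1} = insert k {k<..n + 1}"
    using k by auto
  moreover have "sum x ({1..k} \<union> {k<..n + 1}) = sum x {1..k} + sum x {k<..n + 1}"
    by (intro sum.union_disjoint) auto
  ultimately show ?thesis
    using assms by (simp add: left_mass_def right_mass_def)
qed

lemma mass_down:
  assumes "k \<in> D"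
  shows "left_mass x k + right_mass x k = - x k"
proof -
  have "D \<inter> {..k} = insert k (D \<inter> {..<k})"
    using assms by auto
  then show ?thesis
    using assms disjoint finite_UD by (auto simp: left_mass_def right_mass_def)
qed

text \<open>The vertices of the path that separates the labels in \<open>J\<close> from the others.\<close>

definition bends :: "nat set \<Rightarrow> nat set" where
  "bends J = {0, n + 2} \<union> ((D - J) \<union> (U \<inter> J))"

lemma finite_bends: "finite (bends J)"
  using finite_UD by (simp add: bends_def)

lemma path_edge_bounds: "(i, j) \<in> path_edges (bends J) \<Longrightarrow> i < j \<and> j \<le> n + 2"
  using U_sub D_sub by (force simp: path_edges_def bends_def)

text \<open>By \<open>mass_up\<close> and \<open>mass_down\<close> the two halves at an inner vertex of the path combine to the
  indicator of that vertex, up to sign and a constant.\<close>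

lemma sum_path:
  assumes "J \<subseteq> {1..n + 1}"
  shows "(\<Sum>(i, j)\<in>path_edges (bends J). sum x (below i j)) =
    sum x J + real (card (U \<inter> J)) * sum x {1..n + 1}"
proof -
  have "(\<Sum>(i, j)\<in>path_edges (bends J). sum x (below i j)) =
      (\<Sum>(i, j)\<in>path_edges (bends J). left_mass x i + right_mass x j)"
    by (intro sum.cong) (auto simp: sum_below dest: path_edge_bounds)
  also have "\<dots> = left_mass x 0 + right_mass x (n + 2) +
      (\<Sum>k\<in>(D - J) \<union> (U \<inter> J). left_mass x k + right_mass x k)"
    unfolding bends_def using U_sub D_sub by (intro sum_path_edges_additive) force+
  also have "left_mass x 0 = 0"
    using not_end by (auto simp: left_mass_def intro: sum.neutral)
  also have "D \<inter> {..<n + 2} = D"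
    using D_sub by auto
  then have "right_mass x (n + 2) = sum x D"
    using not_end by (simp add: right_mass_def)
  also have "(\<Sum>k\<in>(D - J) \<union> (U \<inter> J). left_mass x k + right_mass x k) =
      (\<Sum>k\<in>D - J. left_mass x k + right_mass x k) + (\<Sum>k\<in>U \<inter> J. left_mass x k + right_mass x k)"
    using finite_UD disjoint by (intro sum.union_disjoint) auto
  also have "(\<Sum>k\<in>D - J. left_mass x k + right_mass x k) = - sum x (D - J)"
    by (simp add: mass_down sum_negf)
  also have "(\<Sum>k\<in>U \<inter> J. left_mass x k + right_mass x k) =
      real (card (U \<inter> J)) * sum x {1..n + 1} + sum x (U \<inter> J)"
    by (simp add: mass_up sum.distrib)
  also have "sum x D = sum x (D - J) + sum x (D \<inter> J)"
    using finite_UD by (subst sum.union_disjoint[symmetric]) (auto intro: arg_cong[of _ _ "sum x"])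
  finally have *: "(\<Sum>(i, j)\<in>path_edges (bends J). sum x (below i j)) =
      sum x (D \<inter> J) + sum x (U \<inter> J) + real (card (U \<inter> J)) * sum x {1..n + 1}"
    by simp
  have "J = (D \<inter> J) \<union> (U \<inter> J)"
    using assms labels by auto
  then have "sum x J = sum x (D \<inter> J \<union> U \<inter> J)"
    by simp
  then have "sum x J = sum x (D \<inter> J) + sum x (U \<inter> J)"
    using finite_UD disjoint sum.union_disjoint[of "D \<inter> J" "U \<inter> J" x] by auto
  with * show ?thesis
    by simp
qed

abbreviation left_rank :: "nat \<Rightarrow> real" where
  "left_rank \<equiv> left_mass (\<lambda>_. 1)"

abbreviation right_rank :: "nat \<Rightarrow> real" where
  "right_rank \<equiv> right_mass (\<lambda>_. 1)"

lemma card_below: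
  assumes "i < j" "j \<le> n + 2"
  shows "real (card (below i j)) = left_rank i + right_rank j"
  using sum_below[OF assms, of "\<lambda>_. 1"] by simp

text \<open>The product \<open>\<bar>A(i, j)\<bar> \<cdot> \<bar>B(i, j)\<bar>\<close>, written in the ranks so that it also makes sense for \<open>i = j\<close>.
  It vanishes on boundary edges, which have no inequality of their own.\<close>

definition edge_cost :: "nat \<Rightarrow> nat \<Rightarrow> real" where
  "edge_cost i j = (left_rank i + right_rank j) * (n + 1 - (left_rank i + right_rank j))"

text \<open>The lower bound that the inequalities of the path of \<open>J\<close> give for the coordinate sum over \<open>J\<close>.\<close>

definition path_rhs :: "nat set \<Rightarrow> real" where
  "path_rhs J = ((n + 2) * card J - (\<Sum>(i, j)\<in>path_edges (bends J). edge_cost i j)) / 2"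

text \<open>Up to a factor, the mixed second difference of \<open>edge_cost\<close>. Being a product, it controls both the
  marginals of \<open>path_rhs\<close> and its Moebius inverse.\<close>

definition gain :: "nat \<Rightarrow> nat \<Rightarrow> nat \<Rightarrow> nat \<Rightarrow> real" where
  "gain i k l j = (left_rank i - left_rank k) * (right_rank j - right_rank l)"

lemma edge_cost_mixed:
  "edge_cost i l + edge_cost k j - edge_cost i j - edge_cost k l = 2 * gain i k l j"
  by (simp add: edge_cost_def gain_def algebra_simps)

text \<open>The degenerate edge has the formal rank \<open>n + 2\<close> at an up label and \<open>- 1\<close> at a down label, and
  \<open>b (n + 1 - b)\<close> takes the same value at both.\<close>

lemma edge_cost_diag:
  assumes "k \<in> {1..n + 1}"
  shows "edge_cost k k = - real (n + 2)"
proof (cases "k \<in> U")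
  case True
  then show ?thesis
    using mass_up[OF True, of "\<lambda>_. 1"] by (simp add: edge_cost_def)
next
  case False
  then have "k \<in> D"
    using assms up_or_down by blast
  then show ?thesis
    using mass_down[of k "\<lambda>_. 1"] by (simp add: edge_cost_def)
qed

lemma left_rank_le:
  assumes "i < k"
  shows "k \<in> D \<Longrightarrow> left_rank k \<le> left_rank i" "k \<in> U \<Longrightarrow> left_rank i \<le> left_rank k"
proof -
  have mono: "card (D \<inter> {..i}) \<le> card (D \<inter> {..k})"
    using assms finite_UD by (intro card_mono) auto
  show "left_rank k \<le> left_rank i" if "k \<in> D"
    using that mono disjoint by (auto simp: left_mass_def)
  have "D \<inter> {..k} \<subseteq> (D \<inter> {..i}) \<union> {i<..k}"
    by auto
  then have "card (D \<inter> {..k}) \<le> card ((D \<inter> {..i}) \<union> {i<..k})"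
    using finite_UD by (intro card_mono) auto
  also have "\<dots> \<le> card (D \<inter> {..i}) + (k - i)"
    using card_Un_le[of "D \<inter> {..i}" "{i<..k}"] by simp
  finally have "card (D \<inter> {..k}) + i \<le> card (D \<inter> {..i}) + k"
    using assms by simp
  then have *: "real (card (D \<inter> {..k})) + i \<le> card (D \<inter> {..i}) + k"
    by (metis of_nat_add of_nat_le_iff)
  show "left_rank i \<le> left_rank k" if "k \<in> U"
    using that * by (auto simp: left_mass_def)
qed

lemma right_rank_le:
  assumes "k < j" "j \<le> n + 2"
  shows "k \<in> D \<Longrightarrow> right_rank k \<le> right_rank j" "k \<in> U \<Longrightarrow> right_rank j \<le> right_rank k"
proof -
  have mono: "card (D \<inter> {..<k}) \<le> card (D \<inter> {..<j})"
    using assms finite_UD by (intro card_mono) auto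
  show "right_rank k \<le> right_rank j" if "k \<in> D"
    using that mono disjoint by (auto simp: right_mass_def)
  have "D \<inter> {..<j} \<subseteq> (D \<inter> {..<k}) \<union> {k..<j}"
    by auto
  then have "card (D \<inter> {..<j}) \<le> card ((D \<inter> {..<k}) \<union> {k..<j})"
    using finite_UD by (intro card_mono) auto
  also have "\<dots> \<le> card (D \<inter> {..<k}) + (j - k)"
    using card_Un_le[of "D \<inter> {..<k}" "{k..<j}"] by simp
  finally have "card (D \<inter> {..<j}) + k \<le> card (D \<inter> {..<k}) + j"
    using assms by simp
  then have *: "real (card (D \<inter> {..<j})) + k \<le> card (D \<inter> {..<k}) + j"
    by (metis of_nat_add of_nat_le_iff)
  show "right_rank j \<le> right_rank k" if "k \<in> U"
    using that * assms by (auto simp: right_mass_def of_nat_diff)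
qed

text \<open>Inserting an up label into \<open>J\<close> inserts it into the path; inserting a down label removes it.\<close>

lemma path_rhs_insert:
  assumes "e \<in> {1..n + 1}" "e \<notin> J" "finite J"
    and "(i, j) \<in> path_edges (bends J - {e})" "i < e" "e < j"
  shows "path_rhs (insert e J) - path_rhs J = (if e \<in> U then n + 2 - gain i e e j else gain i e e j)"
proof -
  \<comment> \<open>The edge \<open>(i, j)\<close> is split at \<open>e\<close>; the degenerate edge \<open>(e, e)\<close> completes the mixed difference.\<close>
  have cost: "edge_cost i e + edge_cost e j - edge_cost i j = 2 * gain i e e j - (n + 2)"
    using edge_cost_mixed[of i e e j] edge_cost_diag[OF assms(1)] by simp
  define W where "W = bends J - {e}"
  define S where "S = (\<Sum>(i, j)\<in>path_edges W. edge_cost i j)"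
  have step: "(\<Sum>(i, j)\<in>path_edges (insert e W). edge_cost i j) =
      S + (2 * gain i e e j - (n + 2))"
    using sum_path_edges_insert[OF _ assms(4-6), of edge_cost] finite_bends cost
    by (simp add: W_def S_def)
  have card: "real ((n + 2) * card (insert e J)) = real ((n + 2) * card J) + (n + 2)"
    using assms by (simp add: algebra_simps)
  show ?thesis
  proof (cases "e \<in> U")
    case True
    have "bends (insert e J) = insert e W" "bends J = W"
      using True disjoint assms(2) not_end by (auto simp: bends_def W_def)
    then have "path_rhs (insert e J) = (real ((n + 2) * card J) + (n + 2) - (S + (2 * gain i e e j - (n + 2)))) / 2"
      and "path_rhs J = (real ((n + 2) * card J) - S) / 2"
      by (simp_all only: path_rhs_def step card S_def[symmetric])
    moreover have "(N + m - (S + (2 * g - m))) / 2 - (N - S) / 2 = m - g" for N m g :: real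
      by (simp add: field_simps)
    ultimately show ?thesis
      using True by (simp only: if_True)
  next
    case False
    then have "e \<in> D"
      using assms(1) labels by blast
    have "bends (insert e J) = W" "bends J = insert e W"
      using False \<open>e \<in> D\<close> disjoint assms(2) not_end by (auto simp: bends_def W_def)
    then have "path_rhs (insert e J) = (real ((n + 2) * card J) + (n + 2) - S) / 2"
      and "path_rhs J = (real ((n + 2) * card J) - (S + (2 * gain i e e j - (n + 2)))) / 2"
      by (simp_all only: path_rhs_def step card S_def[symmetric])
    moreover have "(N + m - S) / 2 - (N - (S + (2 * g - m))) / 2 = g" for N m g :: real
      by (simp add: field_simps)
    ultimately show ?thesis
      using False by (simp only: if_False)
  qed
qed

lemma bend_edge_across:
  assumes e: "e \<in> {1..n + 1}"
  shows "\<exists>i j. (i, j) \<in> path_edges (bends J - {e}) \<and> i < e \<and> e < j"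
proof -
  have "0 \<in> bends J - {e}" "n + 2 \<in> bends J - {e}" "0 < e" "e < n + 2" "finite (bends J - {e})"
    using e finite_bends by (auto simp: bends_def)
  then show ?thesis
    using edge_across[of "bends J - {e}" e 0 "n + 2"] by blast
qed

text \<open>Enlarging \<open>Q\<close> to \<open>P\<close> changes the neighbours of \<open>e\<close> on the path only by down labels that leave the
  path and up labels that enter it. Either change weakly increases the left rank of the left neighbour and
  the right rank of the right neighbour. The product in \<open>path_rhs_insert\<close> thus grows for a down
  label \<open>e\<close> and shrinks for an up label \<open>e\<close>, so that the marginal value grows in both cases.\<close>

lemma path_rhs_supermodular:
  assumes "Q \<subseteq> P" "P \<subseteq> {1..n + 1}" "e \<in> {1..n + 1} - P"
  shows "path_rhs (insert e Q) - path_rhs Q \<le> path_rhs (insert e P) - path_rhs P"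
proof -
  have fin: "finite P" "finite Q"
    using finite_subset[OF assms(1)] finite_subset[OF assms(2)] by simp_all
  obtain i j where ij: "(i, j) \<in> path_edges (bends Q - {e})" "i < e" "e < j"
    using bend_edge_across assms(3) by blast
  obtain i' j' where ij': "(i', j') \<in> path_edges (bends P - {e})" "i' < e" "e < j'"
    using bend_edge_across assms(3) by blast
  have V: "i \<in> bends Q" "j \<in> bends Q" "i' \<in> bends P" "j' \<in> bends P"
    using ij ij' by (auto simp: path_edges_def)
  have free: "u \<le> i \<or> j \<le> u" if "u \<in> bends Q" "u \<noteq> e" for u
    using ij(1) that by (force simp: path_edges_def)
  have free': "u \<le> i' \<or> j' \<le> u" if "u \<in> bends P" "u \<noteq> e" for u
    using ij'(1) that by (force simp: path_edges_def)
  have jj: "j \<le> n + 2" "j' \<le> n + 2"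
    using V U_sub D_sub by (force simp: bends_def)+
  \<comment> \<open>If the left neighbour moves, it moves to a newly inserted up label or back from a removed down label.\<close>
  have l: "left_rank i \<le> left_rank i'"
  proof (cases i i' rule: linorder_cases)
    case less
    then have "i' \<notin> bends Q"
      using free[of i'] ij ij' by auto
    then have "i' \<in> U"
      using V(3) assms(1) less ij'(2) assms(3) by (auto simp: bends_def)
    then show ?thesis
      using left_rank_le less by blast
  next
    case greater
    then have "i \<notin> bends P"
      using free'[of i] ij ij' by auto
    then have "i \<in> D"
      using V(1) assms(1) greater ij(2) assms(3) by (auto simp: bends_def)
    then show ?thesis
      using left_rank_le greater by blast
  qed auto
  have r: "right_rank j \<le> right_rank j'"
  proof (cases j j' rule: linorder_cases)
    case greater
    then have "j' \<notin> bends Q"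
      using free[of j'] ij ij' by auto
    then have "j' \<in> U"
      using V(4) assms(1) greater ij'(3) assms(3) jj by (auto simp: bends_def)
    then show ?thesis
      using right_rank_le greater jj by blast
  next
    case less
    then have "j \<notin> bends P"
      using free'[of j] ij ij' by auto
    then have "j \<in> D"
      using V(2) assms(1) less ij(3) assms(3) jj by (auto simp: bends_def)
    then show ?thesis
      using right_rank_le less jj by blast
  qed auto
  have "e \<notin> P" "e \<notin> Q" "e \<in> {1..n + 1}"
    using assms by auto
  note marginals = path_rhs_insert[OF this(3,1) fin(1) ij'] path_rhs_insert[OF this(3,2) fin(2) ij]
  show ?thesis
  proof (cases "e \<in> U")
    case True
    have "(left_rank e - left_rank i') * (right_rank e - right_rank j') \<le>
        (left_rank e - left_rank i) * (right_rank e - right_rank j)"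
      using l r left_rank_le(2)[OF ij(2) True] left_rank_le(2)[OF ij'(2) True]
        right_rank_le(2)[OF ij(3) jj(1) True] right_rank_le(2)[OF ij'(3) jj(2) True]
      by (intro mult_mono) auto
    then show ?thesis
      unfolding marginals using True by (simp add: gain_def algebra_simps)
  next
    case False
    then have "e \<in> D"
      using assms up_or_down by blast
    have "(left_rank i - left_rank e) * (right_rank j - right_rank e) \<le>
        (left_rank i' - left_rank e) * (right_rank j' - right_rank e)"
      using l r left_rank_le(1)[OF ij(2) \<open>e \<in> D\<close>] left_rank_le(1)[OF ij'(2) \<open>e \<in> D\<close>]
        right_rank_le(1)[OF ij(3) jj(1) \<open>e \<in> D\<close>] right_rank_le(1)[OF ij'(3) jj(2) \<open>e \<in> D\<close>]
      by (intro mult_mono) auto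
    then show ?thesis
      unfolding marginals using False by (simp add: gain_def)
  qed
qed

subsection \<open>Values on the sets below a diagonal\<close>

lemma edge_cost_card:
  assumes "i < j" "j \<le> n + 2"
  shows "edge_cost i j = real (card (below i j)) * (real n + 1 - real (card (below i j)))"
  using card_below[OF assms] by (simp add: edge_cost_def)

lemma edge_cost_trivial:
  assumes "i < j" "j \<le> n + 2" "below i j = {} \<or> below i j = {1..n + 1}"
  shows "edge_cost i j = 0"
  using assms edge_cost_card by auto

lemma path_rhs_empty: "path_rhs {} = 0"
proof -
  have "edge_cost i j = 0" if "(i, j) \<in> path_edges (bends {})" for i j
  proof (intro edge_cost_trivial disjI1)
    show "i < j" "j \<le> n + 2"
      using path_edge_bounds[OF that] by auto
    show "below i j = {}"
      using that disjoint not_end by (auto simp: below_def path_edges_def bends_def)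
  qed
  then show ?thesis
    by (auto simp: path_rhs_def intro: sum.neutral)
qed

lemma path_rhs_full: "path_rhs {1..n + 1} = real ((n + 2) choose 2)"
proof -
  have "edge_cost i j = 0" if e: "(i, j) \<in> path_edges (bends {1..n + 1})" for i j
  proof (intro edge_cost_trivial disjI2)
    show "i < j" "j \<le> n + 2"
      using path_edge_bounds[OF e] by auto
    have bends: "bends {1..n + 1} = insert 0 (insert (n + 2) U)"
      using labels by (auto simp: bends_def)
    have "k \<in> below i j" if k: "k \<in> {1..n + 1}" for k
    proof -
      have "k \<in> D" if "i < k" "k < j"
      proof -
        have "k \<notin> U"
          using e that unfolding bends path_edges_def by auto
        then show ?thesis
          using up_or_down[OF k] by simp
      qed
      then show ?thesis
        using e k path_edge_bounds[OF e] unfolding bends path_edges_def below_def by auto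
    qed
    then show "below i j = {1..n + 1}"
      using below_sub by blast
  qed
  then have "path_rhs {1..n + 1} = (n + 2) * (n + 1) / 2"
    by (auto simp: path_rhs_def intro: sum.neutral)
  moreover have "real ((n + 2) choose 2) = (n + 2) * (n + 1) / 2"
    by (simp add: choose_two real_of_nat_div)
  ultimately show ?thesis
    by simp
qed

lemma choose_two_card:
  "real ((b + 1) choose 2) = (real ((n + 2) * b) - real b * (real n + 1 - real b)) / 2"
proof -
  have "real ((b + 1) choose 2) = (real b + 1) * real b / 2"
    by (induction b) (simp_all add: numeral_2_eq_2 field_simps)
  then show ?thesis
    by (simp add: field_simps)
qed

text \<open>The path of \<open>below i j\<close> follows one of the two hulls up to \<open>i\<close>, crosses from \<open>i\<close> to \<open>j\<close>, and
  continues along a hull. All edges other than \<open>(i, j)\<close> are boundary edges of cost \<open>0\<close>.\<close>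

lemma path_rhs_below:
  assumes "i < j" "j \<le> n + 2"
  shows "path_rhs (below i j) = real ((card (below i j) + 1) choose 2)"
proof -
  let ?B = "below i j"
  have ends: "i \<in> bends ?B" "j \<in> bends ?B"
    using assms up_or_down[of i] up_or_down[of j] U_sub D_sub disjoint by (auto simp: bends_def below_def)
  have inside: "u \<notin> bends ?B" if "i < u" "u < j" for u
    using that assms disjoint by (auto simp: bends_def below_def)
  have ij: "(i, j) \<in> path_edges (bends ?B)"
    using ends inside assms by (auto simp: path_edges_def)
  have other: "edge_cost i' j' = 0"
    if e: "(i', j') \<in> path_edges (bends ?B)" and ne: "(i', j') \<noteq> (i, j)" for i' j'
  proof (rule edge_cost_trivial)
    have V: "i' \<in> bends ?B" "j' \<in> bends ?B"
      and free: "\<And>u. u \<in> bends ?B \<Longrightarrow> u \<le> i' \<or> j' \<le> u"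
      using e by (force simp: path_edges_def)+
    show b: "i' < j'" "j' \<le> n + 2"
      using path_edge_bounds[OF e] by auto
    have "j' \<le> i \<or> j \<le> i'"
    proof (rule ccontr)
      assume no: "\<not> ?thesis"
      then have "i \<le> i'" "j' \<le> j"
        using free[OF ends(1)] free[OF ends(2)] by auto
      then have "i' = i" "j' = j"
        using inside[of i'] inside[of j'] V b no by (auto simp: le_less)
      then show False
        using ne by simp
    qed
    then consider "j' \<le> i" "i \<in> U" | "j' \<le> i" "i \<in> D" | "j \<le> i'" "j \<in> U" | "j \<le> i'" "j \<in> D"
    proof (elim disjE)
      assume "j' \<le> i"
      moreover then have "i \<noteq> 0" "i \<noteq> n + 2"
        using b assms by auto
      ultimately show ?thesis
        using ends(1) that by (auto simp: bends_def)
    next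
      assume "j \<le> i'"
      moreover then have "j \<noteq> 0" "j \<noteq> n + 2"
        using b assms by auto
      ultimately show ?thesis
        using ends(2) that by (auto simp: bends_def)
    qed
    then show "below i' j' = {} \<or> below i' j' = {1..n + 1}"
    proof cases
      case 1
      then have B: "u \<in> bends ?B \<longleftrightarrow> u = 0 \<or> u \<in> U" if "u \<le> i" for u
        using that assms U_sub D_sub disjoint by (auto simp: bends_def below_def)
      have "k \<in> below i' j'" if k: "k \<in> {1..n + 1}" for k
      proof -
        have "k \<in> D" if "i' < k" "k < j'"
          using free[of k] B[of k] that 1 up_or_down[OF k] by auto
        moreover have "j' \<in> U" "i' = 0 \<or> i' \<in> U"
          using B V 1 b by auto
        ultimately show ?thesis
          using k by (auto simp: below_def)
      qed
      then show ?thesis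
        using below_sub by blast
    next
      case 2
      then have B: "u \<in> bends ?B \<longleftrightarrow> u = 0 \<or> u \<in> D" if "u \<le> i" for u
        using that assms U_sub D_sub disjoint by (auto simp: bends_def below_def)
      have "k \<notin> D" if "i' < k" "k < j'" for k
        using free[of k] B[of k] that 2 by auto
      moreover have "j' \<notin> U" "i' \<notin> U"
        using B V 2 b disjoint not_end by auto
      ultimately show ?thesis
        by (auto simp: below_def)
    next
      case 3
      then have B: "u \<in> bends ?B \<longleftrightarrow> u = n + 2 \<or> u \<in> U" if "j \<le> u" for u
        using that assms U_sub D_sub disjoint by (auto simp: bends_def below_def)
      have "k \<in> below i' j'" if k: "k \<in> {1..n + 1}" for k
      proof -
        have "k \<in> D" if "i' < k" "k < j'"
          using free[of k] B[of k] that 3 up_or_down[OF k] by auto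
        moreover have "i' \<in> U" "j' = n + 2 \<or> j' \<in> U"
          using B V 3 b by auto
        ultimately show ?thesis
          using k by (auto simp: below_def)
      qed
      then show ?thesis
        using below_sub by blast
    next
      case 4
      then have B: "u \<in> bends ?B \<longleftrightarrow> u = n + 2 \<or> u \<in> D" if "j \<le> u" for u
        using that assms U_sub D_sub disjoint by (auto simp: bends_def below_def)
      have "k \<notin> D" if "i' < k" "k < j'" for k
        using free[of k] B[of k] that 4 by auto
      moreover have "j' \<notin> U" "i' \<notin> U"
        using B V 4 b disjoint not_end by auto
      ultimately show ?thesis
        by (auto simp: below_def)
    qed
  qed
  have "(\<Sum>(i, j)\<in>path_edges (bends ?B). edge_cost i j) =
      edge_cost i j + (\<Sum>(i, j)\<in>path_edges (bends ?B) - {(i, j)}. edge_cost i j)"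
    using sum.remove[OF finite_path_edges[OF finite_bends] ij, of "\<lambda>(i, j). edge_cost i j"] by simp
  also have "(\<Sum>(i, j)\<in>path_edges (bends ?B) - {(i, j)}. edge_cost i j) = 0"
    using other by (intro sum.neutral) auto
  finally have "(\<Sum>(i, j)\<in>path_edges (bends ?B). edge_cost i j) = edge_cost i j"
    by simp
  then show ?thesis
    unfolding choose_two_card path_rhs_def edge_cost_card[OF assms] by (rule arg_cong)
qed

subsection \<open>Moebius inversion\<close>

text \<open>The labels that must belong to \<open>J\<close>, and those that must not, for \<open>(i, j)\<close> to be an edge of the path
  of \<open>J\<close>. All labels outside \<open>{i..j}\<close> are free.\<close>

definition forced :: "nat \<Rightarrow> nat \<Rightarrow> nat set" where
  "forced i j = (U \<inter> {i, j}) \<union> (D \<inter> {i<..<j})"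

definition forbidden :: "nat \<Rightarrow> nat \<Rightarrow> nat set" where
  "forbidden i j = (D \<inter> {i, j}) \<union> (U \<inter> {i<..<j})"

lemma path_edges_bends_iff:
  "(i, j) \<in> path_edges (bends J) \<longleftrightarrow>
    i < j \<and> j \<le> n + 2 \<and> forced i j \<subseteq> J \<and> J \<inter> forbidden i j = {}" (is "?L \<longleftrightarrow> ?R")
proof
  assume e: ?L
  then show ?R
    using path_edge_bounds[OF e] disjoint not_end
    unfolding path_edges_def bends_def forced_def forbidden_def by auto
next
  assume r: ?R
  then have "i \<in> {1..n+1} \<or> i = 0" "j \<in> {1..n+1} \<or> j = n + 2"
    by auto
  then show ?L
    using r unfolding path_edges_def bends_def forced_def forbidden_def labels[symmetric] by auto
qed

lemma forced_forbidden: "forced i j \<inter> forbidden i j = {}"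
  using disjoint by (auto simp: forced_def forbidden_def)

text \<open>The edges that survive the alternating sum over all \<open>J \<subseteq> I\<close>: no label of \<open>I\<close> may be free.\<close>

definition supporting_edges :: "nat set \<Rightarrow> (nat \<times> nat) set" where
  "supporting_edges I = {(i, j). i < j \<and> j \<le> n + 2 \<and>
     forced i j \<subseteq> I \<and> I \<subseteq> forced i j \<union> forbidden i j}"

lemma moebius_path_rhs:
  assumes "finite I" "I \<noteq> {}"
  shows "(\<Sum>J | J \<noteq> {} \<and> J \<subseteq> I. (- 1) ^ card (I - J) * path_rhs J) =
    ((if card I = 1 then n + 2 else 0) -
      (\<Sum>(i, j)\<in>supporting_edges I. (- 1) ^ card (I - forced i j) * edge_cost i j)) / 2"
proof -
  let ?s = "\<lambda>J. (- 1) ^ card (I - J) :: real"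
  let ?E = "{(i, j). i < j \<and> j \<le> n + 2}"
  have finE: "finite ?E"
    by (rule finite_subset[of _ "{..n + 2} \<times> {..n + 2}"]) auto
  have finP: "finite {J. J \<subseteq> I}"
    using assms by simp
  have size: "(\<Sum>J | J \<subseteq> I. ?s J * card J) = (if card I = 1 then 1 else 0)"
  proof -
    have "(\<Sum>J | J \<subseteq> I. ?s J * card J) = (\<Sum>J | J \<subseteq> I. \<Sum>k\<in>I. if k \<in> J then ?s J else 0)"
    proof (rule sum.cong[OF refl])
      fix J assume "J \<in> {J. J \<subseteq> I}"
      then have "I \<inter> J = J"
        by auto
      then show "?s J * card J = (\<Sum>k\<in>I. if k \<in> J then ?s J else 0)"
        using assms by (simp add: sum.If_cases)
    qed
    also have "\<dots> = (\<Sum>k\<in>I. \<Sum>J | J \<subseteq> I. if k \<in> J then ?s J else 0)"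
      by (rule sum.swap)
    also have "\<dots> = (\<Sum>k\<in>I. if I = {k} then 1 else 0)"
    proof (rule sum.cong[OF refl])
      fix k assume k: "k \<in> I"
      have "(\<Sum>J | J \<subseteq> I. if k \<in> J then ?s J else 0) =
          (\<Sum>J | J \<subseteq> I \<and> {k} \<subseteq> J \<and> J \<inter> {} = {}. ?s J)"
        using finP by (intro sum.mono_neutral_cong_right) auto
      also have "\<dots> = (if I = {k} then 1 else 0)"
        unfolding sum_alternating_interval[OF assms(1) Int_empty_right] using k by auto
      finally show "(\<Sum>J | J \<subseteq> I. if k \<in> J then ?s J else 0) = (if I = {k} then 1 else 0)" .
    qed
    also have "\<dots> = (if card I = 1 then 1 else 0)"
    proof (cases "card I = 1")
      case True
      then obtain k where "I = {k}"
        by (rule card_1_singletonE)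
      then show ?thesis
        by simp
    next
      case False
      then show ?thesis
        by (auto intro!: sum.neutral)
    qed
    finally show ?thesis .
  qed
  have edges: "(\<Sum>J | J \<subseteq> I. ?s J * (\<Sum>(i, j)\<in>path_edges (bends J). edge_cost i j)) =
      (\<Sum>(i, j)\<in>supporting_edges I. ?s (forced i j) * edge_cost i j)"
  proof -
    have "(\<Sum>J | J \<subseteq> I. ?s J * (\<Sum>(i, j)\<in>path_edges (bends J). edge_cost i j)) =
        (\<Sum>J | J \<subseteq> I. \<Sum>e\<in>?E. if e \<in> path_edges (bends J) then ?s J * (case e of (i, j) \<Rightarrow> edge_cost i j) else 0)"
    proof (rule sum.cong[OF refl])
      fix J
      show "?s J * (\<Sum>(i, j)\<in>path_edges (bends J). edge_cost i j) =
          (\<Sum>e\<in>?E. if e \<in> path_edges (bends J) then ?s J * (case e of (i, j) \<Rightarrow> edge_cost i j) else 0)"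
        unfolding sum_distrib_left using finE
        by (intro sum.mono_neutral_cong_left) (auto dest: path_edge_bounds)
    qed
    also have "\<dots> = (\<Sum>e\<in>?E. \<Sum>J | J \<subseteq> I. if e \<in> path_edges (bends J) then ?s J * (case e of (i, j) \<Rightarrow> edge_cost i j) else 0)"
      by (rule sum.swap)
    also have "\<dots> = (\<Sum>e\<in>?E. if e \<in> supporting_edges I
        then (case e of (i, j) \<Rightarrow> ?s (forced i j) * edge_cost i j) else 0)"
    proof (rule sum.cong[OF refl])
      fix e assume "e \<in> ?E"
      then obtain i j where e: "e = (i, j)" and ij: "i < j" "j \<le> n + 2"
        by auto
      have "(\<Sum>J | J \<subseteq> I. if e \<in> path_edges (bends J) then ?s J * (case e of (i, j) \<Rightarrow> edge_cost i j) else 0) =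
          (\<Sum>J | J \<subseteq> I \<and> forced i j \<subseteq> J \<and> J \<inter> forbidden i j = {}. ?s J * edge_cost i j)"
        using finP ij by (intro sum.mono_neutral_cong_right) (auto simp: e path_edges_bends_iff)
      also have "\<dots> = (if forced i j \<subseteq> I \<and> I \<subseteq> forced i j \<union> forbidden i j
          then ?s (forced i j) else 0) * edge_cost i j"
        unfolding sum_distrib_right[symmetric]
          sum_alternating_interval[OF assms(1) forced_forbidden] ..
      finally show "(\<Sum>J | J \<subseteq> I. if e \<in> path_edges (bends J) then ?s J * (case e of (i, j) \<Rightarrow> edge_cost i j) else 0) =
          (if e \<in> supporting_edges I then (case e of (i, j) \<Rightarrow> ?s (forced i j) * edge_cost i j) else 0)"
        using ij by (auto simp: e supporting_edges_def)
    qed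
    also have "\<dots> = (\<Sum>(i, j)\<in>supporting_edges I. ?s (forced i j) * edge_cost i j)"
      using finE by (intro sum.mono_neutral_cong_right) (auto simp: supporting_edges_def)
    finally show ?thesis .
  qed
  have "(\<Sum>J | J \<noteq> {} \<and> J \<subseteq> I. ?s J * path_rhs J) = (\<Sum>J | J \<subseteq> I. ?s J * path_rhs J)"
    using finP by (intro sum.mono_neutral_left) (auto simp: path_rhs_empty)
  also have "\<dots> = (\<Sum>J | J \<subseteq> I. (n + 2) / 2 * (?s J * card J) -
      1 / 2 * (?s J * (\<Sum>(i, j)\<in>path_edges (bends J). edge_cost i j)))"
    by (intro sum.cong) (auto simp: path_rhs_def field_simps)
  also have "\<dots> = (n + 2) / 2 * (\<Sum>J | J \<subseteq> I. ?s J * card J) -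
      1 / 2 * (\<Sum>J | J \<subseteq> I. ?s J * (\<Sum>(i, j)\<in>path_edges (bends J). edge_cost i j))"
    unfolding sum_subtractf sum_distrib_left ..
  finally show ?thesis
    unfolding size edges by (auto simp: field_simps)
qed

definition lower_labels :: "nat set" where
  "lower_labels = {0, n + 2} \<union> D"

text \<open>A supporting edge spans \<open>I\<close>. An end of it outside \<open>I\<close> cannot be up, as it would be forced into \<open>I\<close>,
  and no lower label may be skipped on the way to \<open>I\<close>; so it is the neighbour of \<open>I\<close> on the lower hull.\<close>

lemma supporting_edges_eq:
  assumes I: "I \<noteq> {}" "I \<subseteq> {1..n + 1}"
    and a: "a \<in> lower_labels" "a < Min I" "lower_labels \<inter> {a<..<Min I} = {}"
    and b: "b \<in> lower_labels" "Max I < b" "lower_labels \<inter> {Max I<..<b} = {}"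
  shows "supporting_edges I = (if D \<inter> {Min I..Max I} \<subseteq> I
    then {(i, j). i < j \<and> i \<in> {a, Min I} \<and> j \<in> {Max I, b}} else {})"
proof -
  let ?m = "Min I" and ?M = "Max I"
  have fin: "finite I"
    using I finite_subset by blast
  then have m: "?m \<in> I" and M: "?M \<in> I" and bounds: "\<And>k. k \<in> I \<Longrightarrow> ?m \<le> k \<and> k \<le> ?M"
    using I by auto
  have mn: "1 \<le> ?m" "?M \<le> n + 1"
    using I m M by auto
  have ab: "a = 0 \<or> a \<in> D" "b = n + 2 \<or> b \<in> D" "b \<le> n + 2"
    using a b mn D_sub m M bounds by (force simp: lower_labels_def)+
  have abU: "a \<notin> U" "b \<notin> U"
    using ab disjoint not_end by auto
  have between: "I \<subseteq> forced i j \<union> forbidden i j \<longleftrightarrow> i \<le> ?m \<and> ?M \<le> j" if "i < j" for i j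
  proof -
    have "forced i j \<union> forbidden i j = {i..j} \<inter> (U \<union> D)"
      using that unfolding forced_def forbidden_def by auto
    then have "I \<subseteq> forced i j \<union> forbidden i j \<longleftrightarrow> I \<subseteq> {i..j}"
      using I(2) labels by blast
    also have "\<dots> \<longleftrightarrow> i \<le> ?m \<and> ?M \<le> j"
      using m M bounds by (meson atLeastAtMost_iff order_trans subset_iff)
    finally show ?thesis .
  qed
  have eq: "supporting_edges I = {(i, j). i < j \<and> j \<le> n + 2 \<and> forced i j \<subseteq> I \<and> i \<le> ?m \<and> ?M \<le> j}"
    unfolding supporting_edges_def using between by blast
  show ?thesis
  proof (cases "D \<inter> {?m..?M} \<subseteq> I")
    case False
    then obtain d where "d \<in> D" "?m \<le> d" "d \<le> ?M" "d \<notin> I"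
      by fastforce
    moreover then have "?m < d" "d < ?M"
      using m M by (auto simp: le_less)
    ultimately show ?thesis
      using False unfolding eq by (auto simp: forced_def)
  next
    case True
    have "(i, j) \<in> supporting_edges I \<longleftrightarrow> i < j \<and> i \<in> {a, ?m} \<and> j \<in> {?M, b}" for i j
    proof
      assume "(i, j) \<in> supporting_edges I"
      then have ij: "i < j" "j \<le> n + 2" "i \<le> ?m" "?M \<le> j" and f: "forced i j \<subseteq> I"
        by (auto simp: eq)
      have "i = a" if "i \<noteq> ?m"
      proof (rule ccontr)
        assume "i \<noteq> a"
        have "i < ?m"
          using ij that by simp
        then have "i \<notin> U"
          using f bounds by (fastforce simp: forced_def)
        then have "i \<in> lower_labels"
          using labels ij \<open>i < ?m\<close> mn by (force simp: lower_labels_def)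
        then have "i < a"
          using a(3) \<open>i \<noteq> a\<close> \<open>i < ?m\<close> by force
        then have "a \<in> D" "a < j"
          using ab a(2) bounds[OF M] bounds[OF m] ij by auto
        then have "a \<in> I"
          using f \<open>i < a\<close> by (auto simp: forced_def)
        then show False
          using a(2) bounds by force
      qed
      moreover have "j = b" if "j \<noteq> ?M"
      proof (rule ccontr)
        assume "j \<noteq> b"
        have "?M < j"
          using ij that by simp
        then have "j \<notin> U"
          using f bounds by (fastforce simp: forced_def)
        then have "j \<in> lower_labels"
          using labels ij \<open>?M < j\<close> mn by (force simp: lower_labels_def)
        then have "b < j"
          using b(3) \<open>j \<noteq> b\<close> \<open>?M < j\<close> by force
        then have "b \<in> D" "i < b"
          using ab b(2) bounds[OF M] bounds[OF m] ij by auto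
        then have "b \<in> I"
          using f \<open>b < j\<close> by (auto simp: forced_def)
        then show False
          using b(2) bounds by force
      qed
      ultimately show "i < j \<and> i \<in> {a, ?m} \<and> j \<in> {?M, b}"
        using ij by auto
    next
      assume r: "i < j \<and> i \<in> {a, ?m} \<and> j \<in> {?M, b}"
      have "k \<in> I" if "k \<in> D" "a < k" "k < b" for k
        using that True a(3) b(3) by (force simp: lower_labels_def)
      then have "forced i j \<subseteq> I"
        using r abU m M a b bounds[OF m] unfolding forced_def by auto
      then show "(i, j) \<in> supporting_edges I"
        using r a b mn ab bounds[OF m] unfolding eq by auto
    qed
    then show ?thesis
      using True by auto
  qed
qed

text \<open>The endpoints of a supporting edge that lie in \<open>I\<close> each flip the sign, so the costs of the four
  edges enter as a mixed second difference.\<close>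

lemma moebius_path_rhs_value:
  assumes I: "I \<noteq> {}" "I \<subseteq> {1..n + 1}"
    and a: "a \<in> lower_labels" "a < Min I" "lower_labels \<inter> {a<..<Min I} = {}"
    and b: "b \<in> lower_labels" "Max I < b" "lower_labels \<inter> {Max I<..<b} = {}"
  shows "(\<Sum>J | J \<noteq> {} \<and> J \<subseteq> I. (- 1) ^ card (I - J) * path_rhs J) =
    (if D \<inter> {Min I..Max I} \<subseteq> I
     then (- 1) ^ card (I \<inter> U) * (left_rank (Min I) - left_rank a) * (right_rank (Max I) - right_rank b) +
       (if \<exists>u\<in>U. I = {u} then n + 2 else 0)
     else 0)"
proof -
  let ?m = "Min I" and ?M = "Max I" and ?\<sigma> = "(- 1) ^ card (I \<inter> U) :: real"
  have fin: "finite I"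
    using I finite_subset by blast
  then have m: "?m \<in> I" and M: "?M \<in> I" and bounds: "\<And>k. k \<in> I \<Longrightarrow> ?m \<le> k \<and> k \<le> ?M"
    using I by auto
  show ?thesis
  proof (cases "D \<inter> {?m..?M} \<subseteq> I")
    case False
    have "card I \<noteq> 1"
    proof
      assume "card I = 1"
      then obtain k where "I = {k}"
        by (rule card_1_singletonE)
      then show False
        using False by auto
    qed
    then show ?thesis
      unfolding moebius_path_rhs[OF fin I(1)] supporting_edges_eq[OF assms] using False by simp
  next
    case True
    have sign: "(- 1) ^ card (I - forced i j) = ?\<sigma> * (- 1) ^ card ({i, j} \<inter> I)"
      if e: "(i, j) \<in> supporting_edges I" for i j
    proof -
      have "I - forced i j = (I \<inter> U - {i, j} \<inter> I) \<union> ({i, j} \<inter> I - I \<inter> U)"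
        using e disjoint I labels unfolding supporting_edges_def forced_def forbidden_def by auto
      then show ?thesis
        using minus_one_card_sym_diff[of "I \<inter> U" "{i, j} \<inter> I"] fin by simp
    qed
    have S: "supporting_edges I = {(i, j). i < j \<and> i \<in> {a, ?m} \<and> j \<in> {?M, b}}"
      using supporting_edges_eq[OF assms] True by simp
    have ab: "a \<notin> I" "b \<notin> I"
      using a b bounds by force+
    have le: "?m \<le> ?M"
      using bounds m by blast
    have "(\<Sum>(i, j)\<in>supporting_edges I. (- 1) ^ card (I - forced i j) * edge_cost i j) =
        (\<Sum>(i, j)\<in>supporting_edges I. ?\<sigma> * (- 1) ^ card ({i, j} \<inter> I) * edge_cost i j)"
      using sign by (intro sum.cong) auto
    also have "\<dots> = ?\<sigma> * (edge_cost a b - edge_cost a ?M - edge_cost ?m b + edge_cost ?m ?M) +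
        (if card I = 1 then ?\<sigma> * (n + 2) else 0)"
    proof (cases "?m = ?M")
      case True
      then have "supporting_edges I = {(a, b), (a, ?M), (?m, b)}"
        unfolding S using a b by auto
      moreover have "I = {?m}"
        using True bounds m by force
      then have "card I = 1"
        by (metis card_1_singleton_iff One_nat_def)
      moreover have diag: "edge_cost ?M ?M = - real n - 2"
        using edge_cost_diag[of ?M] M I by auto
      ultimately show ?thesis
        using True a b ab m M by (simp add: diag Int_insert_left) (simp add: algebra_simps)
    next
      case False
      then have "supporting_edges I = {(a, b), (a, ?M), (?m, b), (?m, ?M)}"
        unfolding S using a b le by auto
      moreover have "card I \<noteq> 1"
      proof
        assume "card I = 1"
        then obtain k where "I = {k}"
          by (rule card_1_singletonE)
        then show False
          using False by simp
      qed
      ultimately show ?thesis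
        using False a b ab m M by (simp add: algebra_simps Int_insert_left)
    qed
    also have "edge_cost a b - edge_cost a ?M - edge_cost ?m b + edge_cost ?m ?M = - 2 * gain a ?m ?M b"
      using edge_cost_mixed[of a ?M ?m b] by simp
    finally have sum: "(\<Sum>(i, j)\<in>supporting_edges I. (- 1) ^ card (I - forced i j) * edge_cost i j) =
        - 2 * ?\<sigma> * gain a ?m ?M b + (if card I = 1 then ?\<sigma> * (n + 2) else 0)"
      by simp
    \<comment> \<open>Only singletons have a contribution of the linear part, which meets the cost of the missing degenerate edge.\<close>
    have single: "((if card I = 1 then n + 2 else 0) - (if card I = 1 then ?\<sigma> * (n + 2) else 0)) / 2 =
        (if \<exists>u\<in>U. I = {u} then n + 2 else 0)"
    proof (cases "card I = 1")
      case True
      then obtain k where "I = {k}"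
        by (rule card_1_singletonE)
      then show ?thesis
        by (cases "k \<in> U") auto
    qed auto
    show ?thesis
      unfolding moebius_path_rhs[OF fin I(1)] sum using True single by (simp add: gain_def field_simps)
  qed
qed

end

section \<open>Lines, segments and hulls in the plane\<close>

lemma line_height_less_iff:
  assumes "fst a < fst b"
  shows "line_height a b t < y \<longleftrightarrow> (snd b - snd a) * (t - fst a) < (y - snd a) * (fst b - fst a)"
  using assms by (simp add: line_height_def field_simps)

lemma less_line_height_iff:
  assumes "fst a < fst b"
  shows "y < line_height a b t \<longleftrightarrow> (y - snd a) * (fst b - fst a) < (snd b - snd a) * (t - fst a)"
  using assms by (simp add: line_height_def field_simps)

lemma line_height_endpoints:
  "line_height a b (fst a) = snd a" "fst a \<noteq> fst b \<Longrightarrow> line_height a b (fst b) = snd b"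
  by (simp_all add: line_height_def)

lemma line_height_convex_comb:
  assumes "fst a < fst b"
  shows "(t, line_height a b t) = (1 - (t - fst a) / (fst b - fst a)) *\<^sub>R a + ((t - fst a) / (fst b - fst a)) *\<^sub>R b"
proof -
  define u where "u = (t - fst a) / (fst b - fst a)"
  have "u * (fst b - fst a) = t - fst a"
    using assms by (simp add: u_def)
  moreover have "line_height a b t = snd a + u * (snd b - snd a)"
    by (simp add: line_height_def u_def)
  ultimately show ?thesis
    unfolding u_def[symmetric] by (intro prod_eqI) (simp_all add: algebra_simps)
qed

lemma line_height_mem_closed_segment:
  assumes "fst a < fst b" "fst a \<le> t" "t \<le> fst b"
  shows "(t, line_height a b t) \<in> closed_segment a b"
proof -
  have "0 \<le> (t - fst a) / (fst b - fst a)" "(t - fst a) / (fst b - fst a) \<le> 1"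
    using assms by auto
  then show ?thesis
    unfolding in_segment using line_height_convex_comb[OF assms(1)] by blast
qed

lemma line_height_mem_open_segment:
  assumes "fst a < fst b" "fst a < t" "t < fst b"
  shows "(t, line_height a b t) \<in> open_segment a b"
proof -
  have "0 < (t - fst a) / (fst b - fst a)" "(t - fst a) / (fst b - fst a) < 1" "a \<noteq> b"
    using assms by auto
  then show ?thesis
    unfolding in_segment using line_height_convex_comb[OF assms(1)] by blast
qed

lemma closed_segment_line_height:
  assumes "fst a < fst b" "w \<in> closed_segment a b"
  shows "fst a \<le> fst w" "fst w \<le> fst b" "snd w = line_height a b (fst w)"
proof -
  obtain u where u: "0 \<le> u" "u \<le> 1" "w = (1 - u) *\<^sub>R a + u *\<^sub>R b"
    using assms(2) by (auto simp: in_segment)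
  have w: "fst w = fst a + u * (fst b - fst a)" "snd w = snd a + u * (snd b - snd a)"
    unfolding u(3) by (simp_all add: algebra_simps)
  show "fst a \<le> fst w"
    using w u assms by simp
  have "u * (fst b - fst a) \<le> 1 * (fst b - fst a)"
    using u assms by (intro mult_right_mono) auto
  then show "fst w \<le> fst b"
    using w by simp
  show "snd w = line_height a b (fst w)"
    using w assms by (simp add: line_height_def)
qed

lemma convex_above_line: "convex {w. line_height a b (fst w) \<le> snd w}"
proof -
  define s where "s = (snd b - snd a) / (fst b - fst a)"
  have "{w. line_height a b (fst w) \<le> snd w} = {w. (- s, 1) \<bullet> w \<ge> snd a - s * fst a}"
    by (auto simp: line_height_def s_def[symmetric] inner_prod_def algebra_simps)
  then show ?thesis
    by (simp add: convex_halfspace_ge)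
qed

lemma convex_abscissa: "convex {w :: real \<times> real. fst w \<in> {l..r}}"
proof -
  have "{w :: real \<times> real. fst w \<in> {l..r}} = {w. (1, 0) \<bullet> w \<ge> l} \<inter> {w. (1, 0) \<bullet> w \<le> r}"
    by (auto simp: inner_prod_def)
  then show ?thesis
    by (simp add: convex_Int convex_halfspace_ge convex_halfspace_le)
qed

text \<open>With \<open>c = 1\<close> the point \<open>a\<close> is the leftmost one, with \<open>c = - 1\<close> the rightmost one.\<close>

lemma convex_hull_horizontally_exposed:
  fixes a w :: "real \<times> real" and c :: real
  assumes "\<And>b. b \<in> T \<Longrightarrow> c * fst a < c * fst b"
    and "w \<in> convex hull (insert a T)" and "fst w = fst a"
  shows "w = a"
proof (cases "T = {}")
  case True
  then show ?thesis
    using assms by simp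
next
  case False
  obtain u v b where uv: "0 \<le> u" "0 \<le> v" "b \<in> convex hull T" "u + v = 1" "w = u *\<^sub>R a + v *\<^sub>R b"
    using assms(2) unfolding convex_hull_insert[OF False] by auto
  have "T \<subseteq> {b. (c, 0) \<bullet> b > c * fst a}"
    using assms(1) by (auto simp: inner_prod_def)
  then have "convex hull T \<subseteq> {b. (c, 0) \<bullet> b > c * fst a}"
    by (intro hull_minimal convex_halfspace_gt)
  then have b: "c * fst a < c * fst b"
    using uv(3) by (auto simp: inner_prod_def)
  have "u = 1 - v"
    using uv(4) by simp
  then have "fst a = (1 - v) * fst a + v * fst b"
    using assms(3) uv(5) by simp
  then have "v * (fst b - fst a) = 0"
    by (auto simp: algebra_simps)
  moreover have "fst a \<noteq> fst b"
    using b by auto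
  ultimately have "v = 0"
    by simp
  then show ?thesis
    using uv \<open>u = 1 - v\<close> by simp
qed

lemma supporting_line:
  fixes S :: "'a::euclidean_space set"
  assumes "convex S" "w \<in> S" "w \<notin> interior S"
  obtains a where "a \<noteq> 0" "\<And>y. y \<in> S \<Longrightarrow> a \<bullet> w \<le> a \<bullet> y"
proof (cases "interior S = {}")
  case True
  then obtain a b where "a \<noteq> 0" "S \<subseteq> {x. a \<bullet> x = b}"
    using empty_interior_subset_hyperplane[OF assms(1)] by blast
  then show ?thesis
    using that[of a] assms(2) by (metis (mono_tags, lifting) mem_Collect_eq order_refl subsetD)
next
  case False
  then have "w \<notin> rel_interior S"
    using assms(3) rel_interior_nonempty_interior by blast
  then show ?thesis
    using supporting_hyperplane_rel_boundary[OF assms(1,2)] that by metis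
qed

lemma lower_hull_alone:
  assumes "v \<in> K" "\<And>w. w \<in> K \<Longrightarrow> fst w = fst v \<Longrightarrow> w = v"
  shows "v \<in> lower_hull K"
  unfolding lower_hull_def mem_Collect_eq
proof (intro conjI ballI impI)
  show "snd v \<le> snd w" if "w \<in> K" "fst w = fst v" for w
    using assms(2)[OF that] by simp
qed fact

lemma lowest_point:
  assumes "compact K" "v \<in> K"
  obtains w where "w \<in> lower_hull K" "fst w = fst v"
proof -
  have "compact (K \<inter> {w. fst w = fst v})"
    using assms(1) by (intro compact_Int_closed closed_Collect_eq continuous_intros)
  moreover have "K \<inter> {w. fst w = fst v} \<noteq> {}"
    using assms(2) by blast
  ultimately obtain w where "w \<in> K \<inter> {w. fst w = fst v}"
    "\<forall>u\<in>K \<inter> {w. fst w = fst v}. snd w \<le> snd u"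
    using continuous_attains_inf[of _ snd] continuous_on_snd[OF continuous_on_id] by blast
  then show ?thesis
    using that[of w] by (auto simp: lower_hull_def)
qed

section \<open>The vertices of a convex polygon relative to its diagonals\<close>

locale labelled_polygon =
  fixes n :: nat and p :: "nat \<Rightarrow> real \<times> real"
  assumes convex_polygon: "convex_polygon n p"
begin

abbreviation "P \<equiv> polygon n p"
abbreviation "U \<equiv> up_labels n p"
abbreviation "D \<equiv> down_labels n p"

lemma abscissa_less: "i < j \<Longrightarrow> j \<le> n + 2 \<Longrightarrow> fst (p i) < fst (p j)"
  using convex_polygon by (auto simp: convex_polygon_def strict_mono_on_def)

lemma vertex_mem: "i \<le> n + 2 \<Longrightarrow> p i \<in> P"
  by (auto simp: polygon_def intro: hull_inc)

lemma vertex_extreme: "i \<le> n + 2 \<Longrightarrow> p i extreme_point_of P"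
  using convex_polygon by (simp add: convex_polygon_def)

lemma convex_P: "convex P"
  by (simp add: polygon_def)

lemma vertex_not_inside:
  "k \<le> n + 2 \<Longrightarrow> a \<in> P \<Longrightarrow> b \<in> P \<Longrightarrow> p k \<notin> open_segment a b"
  using vertex_extreme by (auto simp: extreme_point_of_def)

lemma subpolygon: "S \<subseteq> {..n + 2} \<Longrightarrow> convex hull (p ` S) \<subseteq> P"
  unfolding polygon_def by (intro hull_mono) auto

lemma chord_point:
  assumes "i < k" "k < j" "j \<le> n + 2"
  shows "(fst (p k), line_height (p i) (p j) (fst (p k))) \<in> open_segment (p i) (p j)"
    and "(fst (p k), line_height (p i) (p j) (fst (p k))) \<in> P"
proof -
  show *: "(fst (p k), line_height (p i) (p j) (fst (p k))) \<in> open_segment (p i) (p j)"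
    using assms abscissa_less by (intro line_height_mem_open_segment) auto
  have "closed_segment (p i) (p j) \<subseteq> P"
    using assms by (intro closed_segment_subset vertex_mem convex_P) auto
  then show "(fst (p k), line_height (p i) (p j) (fst (p k))) \<in> P"
    using * segment_open_subset_closed by blast
qed

lemma down_below_chord:
  assumes "i < k" "k < j" "j \<le> n + 2" "k \<in> D"
  shows "snd (p k) < line_height (p i) (p j) (fst (p k))"
proof -
  have "snd (p k) \<le> line_height (p i) (p j) (fst (p k))"
    using assms(4) chord_point(2)[OF assms(1-3)] by (auto simp: down_labels_def lower_hull_def)
  moreover have "snd (p k) \<noteq> line_height (p i) (p j) (fst (p k))"
    using chord_point(1)[OF assms(1-3)] vertex_not_inside[of k "p i" "p j"] vertex_mem assms
    by (metis less_imp_le less_le_trans prod.collapse)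
  ultimately show ?thesis
    by simp
qed

lemma up_above_chord:
  assumes "i < k" "k < j" "j \<le> n + 2" "k \<in> U"
  shows "line_height (p i) (p j) (fst (p k)) < snd (p k)"
proof -
  have "line_height (p i) (p j) (fst (p k)) \<le> snd (p k)"
    using assms(4) chord_point(2)[OF assms(1-3)] by (auto simp: up_labels_def upper_hull_def)
  moreover have "snd (p k) \<noteq> line_height (p i) (p j) (fst (p k))"
    using chord_point(1)[OF assms(1-3)] vertex_not_inside[of k "p i" "p j"] vertex_mem assms
    by (metis less_imp_le less_le_trans prod.collapse)
  ultimately show ?thesis
    by simp
qed

text \<open>A vertex on neither hull would be an inner point of a vertical segment in the polygon, contrary to
  its being a corner.\<close>

lemma vertex_up_or_down:
  assumes "k \<in> {1..n + 1}"
  shows "k \<in> U \<or> k \<in> D"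
proof (rule ccontr)
  assume "\<not> ?thesis"
  then obtain v w where vw: "v \<in> P" "fst v = fst (p k)" "snd (p k) < snd v"
    "w \<in> P" "fst w = fst (p k)" "snd w < snd (p k)"
    using assms vertex_mem[of k]
    by (auto simp: up_labels_def down_labels_def upper_hull_def lower_hull_def not_le)
  define u where "u = (snd (p k) - snd w) / (snd v - snd w)"
  have "0 < u" "u < 1" "w \<noteq> v"
    using vw by (auto simp: u_def)
  moreover have "p k = (1 - u) *\<^sub>R w + u *\<^sub>R v"
  proof (rule prod_eqI)
    show "fst (p k) = fst ((1 - u) *\<^sub>R w + u *\<^sub>R v)"
      using vw by (simp add: algebra_simps)
    have "u * (snd v - snd w) = snd (p k) - snd w"
      using vw by (simp add: u_def)
    then show "snd (p k) = snd ((1 - u) *\<^sub>R w + u *\<^sub>R v)"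
      by (simp add: algebra_simps)
  qed
  ultimately have "p k \<in> open_segment w v"
    by (auto simp: in_segment)
  then show False
    using vertex_not_inside[of k w v] vw assms by auto
qed

sublocale up_down_labels n U D
proof
  show "U \<union> D = {1..n + 1}"
    using vertex_up_or_down unfolding up_labels_def down_labels_def by blast
  have "False" if "k \<in> U" "k \<in> D" for k
  proof -
    have "0 < k" "k < n + 2"
      using that by (auto simp: up_labels_def)
    then show False
      using up_above_chord[of 0 k "n + 2"] down_below_chord[of 0 k "n + 2"] that by auto
  qed
  then show "U \<inter> D = {}"
    by blast
qed

text \<open>No three corners are collinear, so a vertex between two others is strictly above or below their
  chord.\<close>

lemma below_line_middle:
  assumes "i < k" "k < j" "j \<le> n + 2"
  shows "snd (p k) < line_height (p i) (p j) (fst (p k)) \<longleftrightarrow> k \<in> D"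
    and "line_height (p i) (p j) (fst (p k)) < snd (p k) \<longleftrightarrow> k \<in> U"
proof -
  have "k \<in> U \<or> k \<in> D"
    using assms by (intro vertex_up_or_down) auto
  then show "snd (p k) < line_height (p i) (p j) (fst (p k)) \<longleftrightarrow> k \<in> D"
    and "line_height (p i) (p j) (fst (p k)) < snd (p k) \<longleftrightarrow> k \<in> U"
    using down_below_chord[OF assms] up_above_chord[OF assms] by fastforce+
qed

text \<open>Whether the middle one of three vertices lies above the chord of the other two is the orientation
  of the triple; reading the same orientation from the other vertices covers the points outside the
  chord.\<close>

lemma vertex_vs_line:
  assumes "i < j" "j \<le> n + 2" "k \<le> n + 2" "k \<noteq> i" "k \<noteq> j"
  shows "snd (p k) < line_height (p i) (p j) (fst (p k)) \<longleftrightarrow>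
      k < i \<and> i \<in> U \<or> i < k \<and> k < j \<and> k \<in> D \<or> j < k \<and> j \<in> U"
    and "line_height (p i) (p j) (fst (p k)) < snd (p k) \<longleftrightarrow>
      k < i \<and> i \<in> D \<or> i < k \<and> k < j \<and> k \<in> U \<or> j < k \<and> j \<in> D"
proof -
  have x: "fst (p i) < fst (p j)"
    using abscissa_less assms by blast
  consider "k < i" | "i < k" "k < j" | "j < k"
    using assms by linarith
  then have "(snd (p k) < line_height (p i) (p j) (fst (p k)) \<longleftrightarrow>
      k < i \<and> i \<in> U \<or> i < k \<and> k < j \<and> k \<in> D \<or> j < k \<and> j \<in> U) \<and>
    (line_height (p i) (p j) (fst (p k)) < snd (p k) \<longleftrightarrow>
      k < i \<and> i \<in> D \<or> i < k \<and> k < j \<and> k \<in> U \<or> j < k \<and> j \<in> D)"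
  proof cases
    case 1
    then have "fst (p k) < fst (p j)"
      using abscissa_less assms by simp
    note iffs = line_height_less_iff[OF x] less_line_height_iff[OF x]
      line_height_less_iff[OF this] less_line_height_iff[OF this]
    show ?thesis
      using below_line_middle[OF 1 assms(1,2)] 1 assms unfolding iffs by (simp add: algebra_simps)
  next
    case 2
    then show ?thesis
      using below_line_middle[OF 2 assms(2)] by simp
  next
    case 3
    then have "fst (p i) < fst (p k)"
      using abscissa_less assms by simp
    note iffs = line_height_less_iff[OF x] less_line_height_iff[OF x]
      line_height_less_iff[OF this] less_line_height_iff[OF this]
    show ?thesis
      using below_line_middle[OF assms(1) 3 assms(3)] 3 assms unfolding iffs by (simp add: algebra_simps)
  qed
  then show "snd (p k) < line_height (p i) (p j) (fst (p k)) \<longleftrightarrow>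
      k < i \<and> i \<in> U \<or> i < k \<and> k < j \<and> k \<in> D \<or> j < k \<and> j \<in> U"
    and "line_height (p i) (p j) (fst (p k)) < snd (p k) \<longleftrightarrow>
      k < i \<and> i \<in> D \<or> i < k \<and> k < j \<and> k \<in> U \<or> j < k \<and> j \<in> D"
    by blast+
qed

lemma B_set_eq_below:
  assumes "i < j" "j \<le> n + 2"
  shows "B_set n p i j = below i j"
proof (rule set_eqI)
  fix k
  have x: "fst (p i) \<noteq> fst (p j)"
    using abscissa_less[OF assms] by simp
  consider "k \<notin> {1..n + 1}" | "k = i" "k \<in> {1..n + 1}" | "k = j" "k \<in> {1..n + 1}"
    | "k \<in> {1..n + 1}" "k \<noteq> i" "k \<noteq> j"
    by blast
  then show "k \<in> B_set n p i j \<longleftrightarrow> k \<in> below i j"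
  proof cases
    case 1
    then show ?thesis
      using U_sub by (auto simp: B_set_def below_def)
  next
    case 2
    then show ?thesis
      using assms by (auto simp: B_set_def below_def line_height_endpoints)
  next
    case 3
    then show ?thesis
      using assms x by (auto simp: B_set_def below_def line_height_endpoints)
  next
    case 4
    then show ?thesis
      using vertex_vs_line(1)[OF assms, of k] by (auto simp: B_set_def below_def)
  qed
qed

lemma A_set_eq:
  assumes "i < j" "j \<le> n + 2"
  shows "A_set n p i j = {1..n + 1} - below i j"
proof (rule set_eqI)
  fix k
  have x: "fst (p i) \<noteq> fst (p j)"
    using abscissa_less[OF assms] by simp
  consider "k \<notin> {1..n + 1}" | "k = i" "k \<in> {1..n + 1}" | "k = j" "k \<in> {1..n + 1}"
    | "k \<in> {1..n + 1}" "k \<noteq> i" "k \<noteq> j"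
    by blast
  then show "k \<in> A_set n p i j \<longleftrightarrow> k \<in> {1..n + 1} - below i j"
  proof cases
    case 1
    then show ?thesis
      using D_sub by (auto simp: A_set_def)
  next
    case 2
    then show ?thesis
      using assms up_or_down[of i] disjoint by (auto simp: A_set_def below_def line_height_endpoints)
  next
    case 3
    then show ?thesis
      using assms x up_or_down[of j] disjoint by (auto simp: A_set_def below_def line_height_endpoints)
  next
    case 4
    have excl: "x \<in> D \<longleftrightarrow> x \<notin> U" if "x \<in> {1..n + 1}" for x
      using up_or_down[OF that] disjoint by blast
    have "k \<in> A_set n p i j \<longleftrightarrow>
        k < i \<and> i \<in> D \<or> i < k \<and> k < j \<and> k \<in> U \<or> j < k \<and> j \<in> D"
      using 4 vertex_vs_line(2)[OF assms, of k] by (auto simp: A_set_def)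
    moreover have "k < i \<or> i < k \<and> k < j \<or> j < k"
      using 4 by linarith
    ultimately show ?thesis
      using 4 assms excl[of i] excl[of j] excl[of k] unfolding below_def
      by (elim disjE) auto
  qed
qed

text \<open>If a point of the diagonal is not interior, then a supporting line there contains both endpoints,
  hence is the line of the diagonal, and all vertices lie on one side of it.\<close>

lemma internal_or_trivial:
  assumes "i < j" "j \<le> n + 2"
  shows "internal_diagonal n p i j \<or> below i j = {} \<or> below i j = {1..n + 1}"
proof (rule ccontr)
  assume no: "\<not> ?thesis"
  then obtain w where w: "w \<in> open_segment (p i) (p j)" "w \<notin> interior P"
    using assms by (auto simp: internal_diagonal_def)
  have x: "fst (p i) < fst (p j)"
    using abscissa_less assms by blast
  have "closed_segment (p i) (p j) \<subseteq> P"
    using assms by (intro closed_segment_subset vertex_mem convex_P) auto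
  then have "w \<in> P"
    using w(1) segment_open_subset_closed by blast
  then obtain a where a: "a \<noteq> 0" "\<And>y. y \<in> P \<Longrightarrow> a \<bullet> w \<le> a \<bullet> y"
    using supporting_line[OF convex_P _ w(2)] by blast
  obtain u where u: "0 < u" "u < 1" "w = (1 - u) *\<^sub>R p i + u *\<^sub>R p j"
    using w(1) by (auto simp: in_segment)
  have aw: "a \<bullet> w = (1 - u) * (a \<bullet> p i) + u * (a \<bullet> p j)"
    using u by (simp add: inner_add_right)
  have ge: "a \<bullet> w \<le> a \<bullet> p i" "a \<bullet> w \<le> a \<bullet> p j"
    using a(2) vertex_mem assms by auto
  have eq: "a \<bullet> p i = a \<bullet> w" "a \<bullet> p j = a \<bullet> w"
  proof -
    have "(1 - u) * (a \<bullet> p i - a \<bullet> w) + u * (a \<bullet> p j - a \<bullet> w) = 0"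
      using aw by (simp add: algebra_simps)
    moreover have "0 \<le> (1 - u) * (a \<bullet> p i - a \<bullet> w)" "0 \<le> u * (a \<bullet> p j - a \<bullet> w)"
      using ge u by auto
    ultimately have "(1 - u) * (a \<bullet> p i - a \<bullet> w) = 0" "u * (a \<bullet> p j - a \<bullet> w) = 0"
      by linarith+
    then show "a \<bullet> p i = a \<bullet> w" "a \<bullet> p j = a \<bullet> w"
      using u by auto
  qed
  define s where "s = (snd (p j) - snd (p i)) / (fst (p j) - fst (p i))"
  have "a \<bullet> p j - a \<bullet> p i = 0"
    using eq by simp
  then have "fst a * (fst (p j) - fst (p i)) + snd a * (snd (p j) - snd (p i)) = 0"
    by (simp add: inner_prod_def algebra_simps)
  then have slope: "fst a = - snd a * s"
    using x by (simp add: s_def field_simps)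
  then have "snd a \<noteq> 0"
    using a(1) by (auto simp: prod_eq_iff)
  have "0 \<le> snd a * (snd (p k) - line_height (p i) (p j) (fst (p k)))" if "k \<le> n + 2" for k
  proof -
    have "a \<bullet> p k - a \<bullet> p i = snd a * (snd (p k) - line_height (p i) (p j) (fst (p k)))"
      unfolding line_height_def s_def[symmetric] by (simp add: inner_prod_def slope algebra_simps)
    moreover have "a \<bullet> p i \<le> a \<bullet> p k"
      using a(2)[OF vertex_mem[OF that]] eq by simp
    ultimately show ?thesis
      by simp
  qed
  then have same_side: False
    if "k \<le> n + 2" "l \<le> n + 2" "snd (p k) < line_height (p i) (p j) (fst (p k))"
      "line_height (p i) (p j) (fst (p l)) < snd (p l)" for k l
    using that \<open>snd a \<noteq> 0\<close> by (smt (verit) zero_le_mult_iff)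
  have "\<exists>k\<le>n + 2. snd (p k) < line_height (p i) (p j) (fst (p k))"
  proof -
    obtain k where "k \<in> below i j"
      using no by blast
    then consider "i \<in> U" | "j \<in> U" | "i < k" "k < j" "k \<in> D"
      by (auto simp: below_def)
    then show ?thesis
    proof cases
      case 1
      then have "0 < i"
        using not_end by (cases i) auto
      then show ?thesis
        using vertex_vs_line(1)[OF assms, of 0] 1 assms by auto
    next
      case 2
      then have "j < n + 2"
        using not_end assms by (metis le_neq_implies_less)
      then show ?thesis
        using vertex_vs_line(1)[OF assms, of "n + 2"] 2 assms by auto
    next
      case 3
      then show ?thesis
        using vertex_vs_line(1)[OF assms, of k] assms by (intro exI[of _ k]) auto
    qed
  qed
  moreover have "\<exists>k\<le>n + 2. line_height (p i) (p j) (fst (p k)) < snd (p k)"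
  proof -
    obtain k where k: "k \<in> {1..n + 1}" "k \<notin> below i j"
      using no below_sub by blast
    have "i \<in> D" if "k \<le> i"
      using that k up_or_down[of i] assms by (auto simp: below_def)
    moreover have "j \<in> D" if "j \<le> k"
      using that k up_or_down[of j] assms by (auto simp: below_def)
    moreover have "k \<in> U" if "i < k" "k < j"
      using that k up_or_down[of k] assms by (auto simp: below_def)
    ultimately consider "i \<in> D" | "j \<in> D" | "i < k" "k < j" "k \<in> U"
      by (meson linorder_not_le)
    then show ?thesis
    proof cases
      case 1
      then have "0 < i"
        using not_end by (cases i) auto
      then show ?thesis
        using vertex_vs_line(2)[OF assms, of 0] 1 assms by auto
    next
      case 2
      then have "j < n + 2"
        using not_end assms by (metis le_neq_implies_less)
      then show ?thesis
        using vertex_vs_line(2)[OF assms, of "n + 2"] 2 assms by auto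
    next
      case 3
      then show ?thesis
        using vertex_vs_line(2)[OF assms, of k] assms by (intro exI[of _ k]) auto
    qed
  qed
  ultimately show False
    using same_side by blast
qed

section \<open>The tight right-hand sides of the associahedron\<close>

text \<open>The inequalities of the internal edges of the path and the equation of the hyperplane, which takes
  care of the boundary edges, add up to the bound.\<close>

lemma asso_lower_bound:
  assumes x: "x \<in> asso n p" and J: "J \<subseteq> {1..n + 1}"
  shows "path_rhs J \<le> coordinate_sum J x"
proof -
  let ?x = "Poly_Mapping.lookup x" and ?E = "path_edges (bends J)" and ?N = "real ((n + 2) choose 2)"
  have total: "sum ?x {1..n + 1} = ?N"
    using x by (simp add: asso_def)
  have edge: "((n + 2) * card (below i j) - edge_cost i j) / 2 \<le> sum ?x (below i j)"
    if e: "(i, j) \<in> ?E" for i j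
  proof -
    have ij: "i < j" "j \<le> n + 2"
      using path_edge_bounds[OF e] by auto
    have "real ((card (below i j) + 1) choose 2) \<le> sum ?x (below i j)"
      using internal_or_trivial[OF ij]
    proof (elim disjE)
      assume "internal_diagonal n p i j"
      then show ?thesis
        using x unfolding asso_def mem_Collect_eq B_set_eq_below[OF ij, symmetric] by blast
    next
      assume b: "below i j = {1..n + 1}"
      show ?thesis
        unfolding b total by simp
    qed (simp add: numeral_2_eq_2)
    then show ?thesis
      unfolding choose_two_card edge_cost_card[OF ij] .
  qed
  have "(\<Sum>(i, j)\<in>?E. ((n + 2) * card (below i j) - edge_cost i j) / 2) \<le> (\<Sum>(i, j)\<in>?E. sum ?x (below i j))"
    using edge by (intro sum_mono) auto
  also have "\<dots> = sum ?x J + card (U \<inter> J) * ?N"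
    unfolding sum_path[OF J] total ..
  also have "(\<Sum>(i, j)\<in>?E. ((n + 2) * card (below i j) - edge_cost i j) / 2) =
      (n + 2) / 2 * (\<Sum>(i, j)\<in>?E. sum (\<lambda>_. 1) (below i j)) - (\<Sum>(i, j)\<in>?E. edge_cost i j) / 2"
    unfolding sum_distrib_left sum_divide_distrib sum_subtractf[symmetric]
    by (intro sum.cong) (auto simp: field_simps)
  also have "(\<Sum>(i, j)\<in>?E. sum (\<lambda>_. 1) (below i j)) = real (card J) + card (U \<inter> J) * (real n + 1)"
    unfolding sum_path[OF J] by simp
  finally have "(n + 2) / 2 * (real (card J) + card (U \<inter> J) * (real n + 1)) - (\<Sum>(i, j)\<in>?E. edge_cost i j) / 2
      \<le> sum ?x J + card (U \<inter> J) * ?N" .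
  moreover have "?N = (real n + 2) * (real n + 1) / 2"
    using choose_two_card[of "n + 1"] by (simp add: algebra_simps)
  then have "card (U \<inter> J) * ?N = (n + 2) / 2 * (card (U \<inter> J) * (real n + 1))"
    by simp
  moreover have "path_rhs J = (n + 2) / 2 * real (card J) - (\<Sum>(i, j)\<in>?E. edge_cost i j) / 2"
    by (simp add: path_rhs_def field_simps)
  ultimately show ?thesis
    unfolding distrib_left by linarith
qed

lemma attains_min_asso:
  assumes J: "J \<subseteq> {1..n + 1}"
  shows "attains_min (coordinate_sum J) (asso n p) (path_rhs J)"
proof -
  obtain x where x: "sum x {1..n + 1} = path_rhs {1..n + 1}" "sum x J = path_rhs J"
    "\<And>K. K \<subseteq> {1..n + 1} \<Longrightarrow> path_rhs K \<le> sum x K"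
    using supermodular_greedy[of "{1..n + 1}" J path_rhs] J path_rhs_empty path_rhs_supermodular by auto
  define X where "X = Abs_poly_mapping (\<lambda>k. if k \<in> {1..n + 1} then x k else 0)"
  have "finite {k. (if k \<in> {1..n + 1} then x k else 0) \<noteq> 0}"
    by (rule finite_subset[of _ "{1..n + 1}"]) auto
  then have X: "Poly_Mapping.lookup X = (\<lambda>k. if k \<in> {1..n + 1} then x k else 0)"
    unfolding X_def by (rule lookup_Abs_poly_mapping)
  have sums: "coordinate_sum K X = sum x K" if "K \<subseteq> {1..n + 1}" for K
    unfolding X using that by (intro sum.cong) auto
  have "X \<in> asso n p"
    unfolding asso_def mem_Collect_eq
  proof (intro conjI allI impI)
    show "Poly_Mapping.keys X \<subseteq> {1..n + 1}"
      by (auto simp: in_keys_iff X split: if_splits)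
    show "coordinate_sum {1..n + 1} X = real ((n + 2) choose 2)"
      using sums[of "{1..n + 1}"] x(1) path_rhs_full by simp
    fix i j assume "internal_diagonal n p i j"
    then have ij: "i < j" "j \<le> n + 2"
      by (auto simp: internal_diagonal_def)
    show "real ((card (B_set n p i j) + 1) choose 2) \<le> coordinate_sum (B_set n p i j) X"
      unfolding B_set_eq_below[OF ij] path_rhs_below[OF ij, symmetric] sums[OF below_sub]
      by (rule x(3)[OF below_sub])
  qed
  moreover have "coordinate_sum J X = path_rhs J"
    using sums[OF J] x(2) by simp
  ultimately show ?thesis
    unfolding attains_min_def using asso_lower_bound[OF _ J] by blast
qed

lemma tight_rhs_asso:
  assumes "J \<subseteq> {1..n + 1}"
  shows "tight_rhs (asso n p) J = path_rhs J"
  unfolding tight_rhs_def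
proof (rule Least_equality)
  show "path_rhs J \<in> coordinate_sum J ` asso n p"
    using attains_min_asso[OF assms] unfolding attains_min_def by force
  show "path_rhs J \<le> z" if "z \<in> coordinate_sum J ` asso n p" for z
    using that attains_min_asso[OF assms] by (auto simp: attains_min_def)
qed

lemma dilation_factor_asso:
  assumes "I \<subseteq> {1..n + 1}"
  shows "dilation_factor (asso n p) I = (\<Sum>J | J \<noteq> {} \<and> J \<subseteq> I. (- 1) ^ card (I - J) * path_rhs J)"
  unfolding dilation_factor_def using assms by (intro sum.cong) (auto simp: tight_rhs_asso)

lemma minkowski_decomposition_unique:
  assumes "minkowski_decomposition n (asso n p) y" "I \<noteq> {}" "I \<subseteq> {1..n + 1}"
  shows "y I = dilation_factor (asso n p) I"
  unfolding dilation_factor_asso[OF assms(3)]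
proof (rule moebius_inversion[symmetric])
  show "finite I"
    using assms(3) by (rule finite_subset) simp
  show "path_rhs J = (\<Sum>K | K \<noteq> {} \<and> K \<subseteq> J. y K)" if "J \<noteq> {}" "J \<subseteq> I" for J
    using that assms(3) by (intro minkowski_decomposition_min[OF assms(1)] attains_min_asso) auto
qed fact

section \<open>Big tops\<close>

lemma lower_labels_bound: "i \<in> lower_labels \<Longrightarrow> i \<le> n + 2"
  using D_sub by (auto simp: lower_labels_def)

lemma lower_labels_not_up: "i \<in> lower_labels \<Longrightarrow> i \<notin> U"
  using disjoint not_end by (auto simp: lower_labels_def)

lemma end_lower_labels: "0 \<in> lower_labels" "n + 2 \<in> lower_labels"
  by (auto simp: lower_labels_def)

lemma finite_lower_labels: "finite lower_labels"
  using finite_UD by (simp add: lower_labels_def)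

lemma leftmost_unique:
  assumes "S \<subseteq> {..n + 2}" "S \<noteq> {}" "w \<in> convex hull (p ` S)" "fst w = fst (p (Min S))"
  shows "w = p (Min S)"
proof -
  have fin: "finite S"
    using assms(1) finite_subset by blast
  have S: "insert (Min S) (S - {Min S}) = S"
    using assms(2) fin by (simp add: insert_absorb)
  have "1 * fst (p (Min S)) < 1 * fst b" if b: "b \<in> p ` (S - {Min S})" for b
  proof -
    obtain k where k: "b = p k" "k \<in> S" "k \<noteq> Min S"
      using b by blast
    have "Min S < k"
      using Min_le[OF fin k(2)] k(3) by linarith
    moreover have "k \<le> n + 2"
      using k(2) assms(1) by blast
    ultimately show ?thesis
      using abscissa_less[of "Min S" k] k(1) by simp
  qed
  moreover have "w \<in> convex hull insert (p (Min S)) (p ` (S - {Min S}))"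
    using assms(3) unfolding image_insert[symmetric] S .
  ultimately show ?thesis
    using assms(4) by (rule convex_hull_horizontally_exposed)
qed

lemma rightmost_unique:
  assumes "S \<subseteq> {..n + 2}" "S \<noteq> {}" "w \<in> convex hull (p ` S)" "fst w = fst (p (Max S))"
  shows "w = p (Max S)"
proof -
  have fin: "finite S"
    using assms(1) finite_subset by blast
  have S: "insert (Max S) (S - {Max S}) = S"
    using assms(2) fin by (simp add: insert_absorb)
  have "- 1 * fst (p (Max S)) < - 1 * fst b" if b: "b \<in> p ` (S - {Max S})" for b
  proof -
    obtain k where k: "b = p k" "k \<in> S" "k \<noteq> Max S"
      using b by blast
    have "k < Max S"
      using Max_ge[OF fin k(2)] k(3) by linarith
    moreover have "Max S \<le> n + 2"
      using Max_in[OF fin assms(2)] assms(1) by blast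
    ultimately show ?thesis
      using abscissa_less[of k "Max S"] k(1) by simp
  qed
  moreover have "w \<in> convex hull insert (p (Max S)) (p ` (S - {Max S}))"
    using assms(3) unfolding image_insert[symmetric] S .
  ultimately show ?thesis
    using assms(4) by (rule convex_hull_horizontally_exposed)
qed

lemma vertex_lower_hull_iff:
  assumes "i \<le> n + 2"
  shows "p i \<in> lower_hull P \<longleftrightarrow> i \<in> lower_labels"
proof -
  have P: "P = convex hull (p ` {..n + 2})"
    by (simp add: polygon_def)
  have "Min {..n + 2} = 0" "Max {..n + 2} = n + 2"
    by (auto intro: Min_eqI Max_eqI)
  then have "w = p 0" if "w \<in> P" "fst w = fst (p 0)" for w
    using leftmost_unique[of "{..n + 2}" w] that P by auto
  then have 0: "p 0 \<in> lower_hull P"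
    using vertex_mem[of 0] by (intro lower_hull_alone) simp_all
  have "w = p (n + 2)" if "w \<in> P" "fst w = fst (p (n + 2))" for w
    using rightmost_unique[of "{..n + 2}" w] that P \<open>Max {..n + 2} = n + 2\<close> by auto
  then have N: "p (n + 2) \<in> lower_hull P"
    using vertex_mem[of "n + 2"] by (intro lower_hull_alone) simp_all
  consider "i = 0" | "i = n + 2" | "i \<in> {1..n + 1}"
    using assms by fastforce
  then show ?thesis
  proof cases
    case 1
    then show ?thesis
      using 0 end_lower_labels by simp
  next
    case 2
    then show ?thesis
      using N end_lower_labels by simp
  next
    case 3
    then have "i \<in> lower_labels \<longleftrightarrow> i \<in> D"
      by (auto simp: lower_labels_def)
    moreover have "i \<in> D \<longleftrightarrow> p i \<in> lower_hull P"
      using 3 by (simp add: down_labels_def)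
    ultimately show ?thesis
      by simp
  qed
qed

lemma lower_edge:
  assumes "i \<in> lower_labels" "j \<in> lower_labels" "i < j" "lower_labels \<inter> {i<..<j} = {}"
  shows "closed_segment (p i) (p j) \<subseteq> lower_hull P"
proof
  fix w assume w: "w \<in> closed_segment (p i) (p j)"
  have ij: "j \<le> n + 2" "i \<le> n + 2"
    using assms lower_labels_bound by auto
  have x: "fst (p i) < fst (p j)"
    using abscissa_less assms ij by blast
  have "line_height (p i) (p j) (fst (p k)) \<le> snd (p k)" if k: "k \<le> n + 2" for k
  proof (cases "k = i \<or> k = j")
    case True
    then show ?thesis
      using x by (auto simp: line_height_endpoints)
  next
    case False
    have "i \<notin> U" "j \<notin> U"
      using assms lower_labels_not_up by auto
    moreover have "k \<notin> D" if "i < k" "k < j"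
      using assms(4) that by (auto simp: lower_labels_def)
    ultimately show ?thesis
      using vertex_vs_line(1)[OF assms(3) ij(1) k] False by (meson linorder_not_le)
  qed
  then have "P \<subseteq> {w. line_height (p i) (p j) (fst w) \<le> snd w}"
    unfolding polygon_def by (intro hull_minimal convex_above_line) auto
  moreover have "w \<in> P"
    using w closed_segment_subset[OF vertex_mem[OF ij(2)] vertex_mem[OF ij(1)] convex_P] by blast
  moreover have "snd w = line_height (p i) (p j) (fst w)"
    using closed_segment_line_height[OF x w] by simp
  ultimately show "w \<in> lower_hull P"
    by (auto simp: lower_hull_def)
qed

lemma hull_abscissa:
  assumes "S \<subseteq> {..n + 2}" "S \<noteq> {}" "w \<in> convex hull (p ` S)"
  shows "fst (p (Min S)) \<le> fst w" "fst w \<le> fst (p (Max S))"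
proof -
  have fin: "finite S"
    using assms(1) finite_subset by blast
  have "p ` S \<subseteq> {w. fst w \<in> {fst (p (Min S))..fst (p (Max S))}}"
  proof
    fix v assume "v \<in> p ` S"
    then obtain k where k: "v = p k" "k \<in> S"
      by blast
    have mono: "fst (p i) \<le> fst (p j)" if "i \<le> j" "j \<le> n + 2" for i j
      using abscissa_less[of i j] that by (cases "i = j") auto
    have "Min S \<le> k" "k \<le> Max S" "k \<le> n + 2" "Max S \<le> n + 2"
      using fin k assms by auto
    then show "v \<in> {w. fst w \<in> {fst (p (Min S))..fst (p (Max S))}}"
      using mono k by simp
  qed
  then have "convex hull (p ` S) \<subseteq> {w. fst w \<in> {fst (p (Min S))..fst (p (Max S))}}"
    by (intro hull_minimal convex_abscissa)
  then show "fst (p (Min S)) \<le> fst w" "fst w \<le> fst (p (Max S))"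
    using assms(3) by auto
qed

text \<open>The lowest point of the cell at the abscissa of \<open>p d\<close> lies on the lower hull of the polygon and is therefore
  the corner \<open>p d\<close>; a corner of the polygon in the hull of other vertices is one of them.\<close>

lemma lower_vertex_in_cell:
  assumes S: "S \<subseteq> {..n + 2}" "Min S < d" "d < Max S" "d \<in> lower_labels"
    and sub: "lower_hull (convex hull (p ` S)) \<subseteq> lower_hull P" and ne: "S \<noteq> {}"
  shows "d \<in> S"
proof -
  have fin: "finite S"
    using S(1) finite_subset by blast
  have ends: "Min S \<in> S" "Max S \<in> S" "Max S \<le> n + 2"
    using fin ne S(1) by auto
  have "(fst (p d), line_height (p (Min S)) (p (Max S)) (fst (p d))) \<in> closed_segment (p (Min S)) (p (Max S))"
    using abscissa_less S ends by (intro line_height_mem_closed_segment) (auto intro: less_imp_le)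
  moreover have "closed_segment (p (Min S)) (p (Max S)) \<subseteq> convex hull (p ` S)"
    using ends by (intro closed_segment_subset convex_convex_hull hull_inc) auto
  ultimately have "(fst (p d), line_height (p (Min S)) (p (Max S)) (fst (p d))) \<in> convex hull (p ` S)"
    by blast
  then obtain w where w: "w \<in> lower_hull (convex hull (p ` S))" "fst w = fst (p d)"
    using lowest_point[of "convex hull (p ` S)"] fin by (metis compact_convex_hull finite_imageI finite_imp_compact fst_conv)
  have "p d \<in> lower_hull P"
    using vertex_lower_hull_iff S lower_labels_bound by blast
  moreover have "w \<in> lower_hull P"
    using w(1) sub by blast
  ultimately have "snd w = snd (p d)"
    using w(2) by (intro order_antisym) (simp_all add: lower_hull_def)
  then have "w = p d"
    using w(2) by (intro prod_eqI)
  then have "p d \<in> convex hull (p ` S)"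
    using w(1) by (simp add: lower_hull_def)
  then have "p d extreme_point_of convex hull (p ` S)"
    using vertex_extreme[of d] lower_labels_bound[OF S(4)] subpolygon[OF S(1)]
    unfolding extreme_point_of_def by blast
  then have "p d \<in> p ` S"
    by (rule extreme_point_of_convex_hull)
  then obtain k where k: "k \<in> S" "p d = p k"
    by blast
  then have "k \<le> n + 2" "d \<le> n + 2"
    using S(1,4) lower_labels_bound by auto
  then have "k = d"
    using abscissa_less[of k d] abscissa_less[of d k] k by (metis less_irrefl linorder_neqE_nat)
  then show ?thesis
    using k by simp
qed

text \<open>The lower hull of a big top runs along the lower hull of the polygon and so meets every vertex of it
  in its range. Conversely, if the cell contains all these vertices, then its lower hull cannot be
  strictly above the edges that join them.\<close>

lemma big_top_cell_iff:
  "big_top_cell n p S \<longleftrightarrow> cell n S \<and> Min S \<in> lower_labels \<and> Max S \<in> lower_labels \<and>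
     lower_labels \<inter> {Min S..Max S} \<subseteq> S"
proof (cases "cell n S")
  case False
  then show ?thesis
    by (simp add: big_top_cell_def)
next
  case cell: True
  then have S: "S \<subseteq> {..n + 2}" "3 \<le> card S"
    by (auto simp: cell_def)
  then have fin: "finite S" and ne: "S \<noteq> {}"
    using finite_subset by (blast, force)
  then have ends: "Min S \<in> S" "Max S \<in> S"
    by auto
  have ends_le: "Min S \<le> n + 2" "Max S \<le> n + 2"
    using ends S by auto
  have "Min S \<noteq> Max S"
  proof
    assume *: "Min S = Max S"
    have "S \<subseteq> {Min S}"
      using * fin by (metis Max_ge Min_le le_antisym singletonI subsetI)
    then have "card S \<le> 1"
      using card_mono[of "{Min S}" S] by simp
    then show False
      using S(2) by simp
  qed
  then have less: "Min S < Max S"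
    using fin ends by (simp add: le_neq_implies_less)
  have hull: "convex hull (p ` S) \<subseteq> P" and vertices: "\<And>k. k \<in> S \<Longrightarrow> p k \<in> convex hull (p ` S)"
    using subpolygon[OF S(1)] by (auto intro: hull_inc)
  show ?thesis
  proof
    assume "big_top_cell n p S"
    then have sub: "lower_hull (convex hull (p ` S)) \<subseteq> lower_hull P"
      by (simp add: big_top_cell_def)
    have "p (Min S) \<in> lower_hull (convex hull (p ` S))"
      by (intro lower_hull_alone leftmost_unique[OF S(1) ne] vertices ends)
    then have min: "Min S \<in> lower_labels"
      using sub vertex_lower_hull_iff[OF ends_le(1)] by blast
    have "p (Max S) \<in> lower_hull (convex hull (p ` S))"
      by (intro lower_hull_alone rightmost_unique[OF S(1) ne] vertices ends)
    then have max: "Max S \<in> lower_labels"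
      using sub vertex_lower_hull_iff[OF ends_le(2)] by blast
    have "d \<in> S" if "d \<in> lower_labels \<inter> {Min S..Max S}" for d
      using that lower_vertex_in_cell[OF S(1) _ _ _ sub ne, of d] ends by (auto simp: le_less)
    then show "cell n S \<and> Min S \<in> lower_labels \<and> Max S \<in> lower_labels \<and>
        lower_labels \<inter> {Min S..Max S} \<subseteq> S"
      using cell min max by blast
  next
    assume r: "cell n S \<and> Min S \<in> lower_labels \<and> Max S \<in> lower_labels \<and>
        lower_labels \<inter> {Min S..Max S} \<subseteq> S"
    have "w \<in> lower_hull P" if w: "w \<in> lower_hull (convex hull (p ` S))" for w
    proof -
      have wS: "w \<in> convex hull (p ` S)"
        using w by (simp add: lower_hull_def)
      let ?A = "{i \<in> lower_labels. Min S \<le> i \<and> i < Max S \<and> fst (p i) \<le> fst w}"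
      define i where "i = Max ?A"
      have "finite ?A" "?A \<noteq> {}"
        using finite_lower_labels r less hull_abscissa[OF S(1) ne wS] by auto
      then have i: "i \<in> lower_labels" "Min S \<le> i" "i < Max S" "fst (p i) \<le> fst w"
        and i_max: "\<And>k. k \<in> ?A \<Longrightarrow> k \<le> i"
        using Max_in[of ?A] by (auto simp: i_def)
      let ?B = "{j \<in> lower_labels. i < j \<and> j \<le> Max S}"
      define j where "j = Min ?B"
      have finB: "finite ?B" "?B \<noteq> {}"
        using finite_lower_labels r i by auto
      then have j: "j \<in> lower_labels" "i < j" "j \<le> Max S"
        using Min_in[of ?B] by (auto simp: j_def)
      have gap: "lower_labels \<inter> {i<..<j} = {}"
      proof (rule ccontr)
        assume "\<not> ?thesis"
        then obtain k where "k \<in> lower_labels" "i < k" "k < j"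
          by auto
        then have "j \<le> k"
          unfolding j_def using finB j by (intro Min_le) auto
        then show False
          using \<open>k < j\<close> by simp
      qed
      have "fst w \<le> fst (p j)"
      proof (cases "j = Max S")
        case True
        then show ?thesis
          using hull_abscissa[OF S(1) ne wS] by simp
      next
        case False
        then show ?thesis
          using i_max[of j] i j by (cases "fst (p j) \<le> fst w") auto
      qed
      moreover have x: "fst (p i) < fst (p j)"
        using abscissa_less j ends_le by simp
      ultimately have v: "(fst w, line_height (p i) (p j) (fst w)) \<in> closed_segment (p i) (p j)" (is "?v \<in> _")
        using i by (intro line_height_mem_closed_segment)
      have "i \<in> S" "j \<in> S"
        using i j r by auto
      then have "closed_segment (p i) (p j) \<subseteq> convex hull (p ` S)"
        by (intro closed_segment_subset vertices convex_convex_hull)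
      then have "?v \<in> convex hull (p ` S)"
        using v by blast
      then have wv: "snd w \<le> snd ?v"
        using w unfolding lower_hull_def mem_Collect_eq by (metis fst_conv)
      have vP: "?v \<in> lower_hull P"
        using v lower_edge[OF i(1) j(1,2) gap] by blast
      show ?thesis
        unfolding lower_hull_def mem_Collect_eq
      proof (intro conjI ballI impI)
        show "w \<in> P"
          using wS hull by blast
        show "snd w \<le> snd u" if u: "u \<in> P" "fst u = fst w" for u
        proof -
          have "snd ?v \<le> snd u"
            using vP u unfolding lower_hull_def mem_Collect_eq by (metis fst_conv)
          then show ?thesis
            using wv by simp
        qed
      qed
    qed
    then show "big_top_cell n p S"
      using cell by (auto simp: big_top_cell_def)
  qed
qed

lemma lower_hull_edge_iff:
  assumes "big_top_cell n p S" "i \<in> S" "j \<in> S" "i < j" "lower_labels \<inter> {i<..<j} = {}"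
  shows "closed_segment (p i) (p j) \<subseteq> lower_hull (convex hull (p ` S)) \<longleftrightarrow>
    i \<in> lower_labels \<and> j \<in> lower_labels"
proof -
  have S: "S \<subseteq> {..n + 2}"
    using assms(1) by (simp add: big_top_cell_def cell_def)
  show ?thesis
  proof
    assume "closed_segment (p i) (p j) \<subseteq> lower_hull (convex hull (p ` S))"
    also have "\<dots> \<subseteq> lower_hull P"
      using assms(1) by (simp add: big_top_cell_def)
    finally show "i \<in> lower_labels \<and> j \<in> lower_labels"
      using vertex_lower_hull_iff S assms(2,3) by (meson atMost_iff ends_in_segment subsetD)
  next
    assume "i \<in> lower_labels \<and> j \<in> lower_labels"
    then have "closed_segment (p i) (p j) \<subseteq> lower_hull P"
      using lower_edge assms by blast
    moreover have "closed_segment (p i) (p j) \<subseteq> convex hull (p ` S)"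
      using assms by (intro closed_segment_subset convex_convex_hull hull_inc) auto
    ultimately show "closed_segment (p i) (p j) \<subseteq> lower_hull (convex hull (p ` S))"
      using subpolygon[OF S] unfolding lower_hull_def by blast
  qed
qed

lemma big_top_cell_with_intermediate_iff:
  assumes I: "I \<noteq> {}" "I \<subseteq> {1..n + 1}"
    and a: "a \<in> lower_labels" "a < Min I" "lower_labels \<inter> {a<..<Min I} = {}"
    and b: "b \<in> lower_labels" "Max I < b" "lower_labels \<inter> {Max I<..<b} = {}"
  shows "big_top_cell n p S \<and> intermediate S = I \<longleftrightarrow>
    S = insert a (insert b I) \<and> D \<inter> {Min I..Max I} \<subseteq> I"
proof -
  have fin: "finite I"
    using I(2) by (rule finite_subset) simp
  then have m: "Min I \<in> I" and M: "Max I \<in> I" and bounds: "\<And>k. k \<in> I \<Longrightarrow> Min I \<le> k \<and> k \<le> Max I"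
    using I by auto
  show ?thesis
  proof
    assume l: "big_top_cell n p S \<and> intermediate S = I"
    then have cell: "S \<subseteq> {..n + 2}" and low: "Min S \<in> lower_labels" "Max S \<in> lower_labels"
      and sub: "lower_labels \<inter> {Min S..Max S} \<subseteq> S" and IS: "I = S - {Min S, Max S}"
      by (auto simp: big_top_cell_iff cell_def intermediate_def)
    have finS: "finite S" "S \<noteq> {}"
      using cell finite_subset m IS by (blast, blast)
    have sm: "Min S < Min I"
      using m IS finS by (metis DiffD1 DiffD2 Min_le insertI1 le_neq_implies_less)
    have Mt: "Max I < Max S"
      using M IS finS by (metis DiffD1 DiffD2 Max_ge insertI1 insertI2 le_neq_implies_less)
    have lI: "d \<in> I" if "d \<in> lower_labels" "Min S < d" "d < Max S" for d
      using that sub IS by auto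
    have mM: "Min I \<le> Max I"
      using bounds m by blast
    have "Min S = a"
    proof (cases a "Min S" rule: linorder_cases)
      case less
      then show ?thesis
        using a(3) low sm by auto
    next
      case greater
      then have "a \<in> I"
        using lI a(1,2) Mt mM by auto
      then show ?thesis
        using bounds a(2) by force
    qed simp
    moreover have "Max S = b"
    proof (cases "Max S" b rule: linorder_cases)
      case less
      then show ?thesis
        using b(3) low Mt by auto
    next
      case greater
      then have "b \<in> I"
        using lI b(1,2) sm mM by auto
      then show ?thesis
        using bounds b(2) by force
    qed simp
    moreover have "S = insert (Min S) (insert (Max S) I)"
      using IS Min_in[OF finS] Max_in[OF finS] by blast
    moreover have "D \<inter> {Min I..Max I} \<subseteq> I"
      using lI sm Mt by (auto simp: lower_labels_def)
    ultimately show "S = insert a (insert b I) \<and> D \<inter> {Min I..Max I} \<subseteq> I"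
      by simp
  next
    assume r: "S = insert a (insert b I) \<and> D \<inter> {Min I..Max I} \<subseteq> I"
    have finS: "finite S"
      using r fin by simp
    have ab: "a < b" "a \<notin> I" "b \<notin> I"
      using a b bounds m by force+
    have hull: "a \<le> k" "k \<le> b" if "k \<in> S" for k
      using that r bounds[of k] a(2) b(2) ab(1) by auto
    have min: "Min S = a"
      using finS hull(1) r by (intro Min_eqI) auto
    have max: "Max S = b"
      using finS hull(2) r by (intro Max_eqI) auto
    have "a \<noteq> b" "Min I \<noteq> a" "Min I \<noteq> b"
      using ab m by (simp, metis, metis)
    then have "{a, b, Min I} \<subseteq> S" "card {a, b, Min I} = 3"
      using r m by auto
    then have "3 \<le> card S"
      using finS by (metis card_mono)
    then have "cell n S"
      using r I a b lower_labels_bound by (auto simp: cell_def)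
    moreover have "lower_labels \<inter> {a..b} \<subseteq> S"
    proof
      fix d assume d: "d \<in> lower_labels \<inter> {a..b}"
      show "d \<in> S"
      proof (cases "d = a \<or> d = b")
        case False
        then have "Min I \<le> d" "d \<le> Max I"
          using d a(3) b(3) by (auto simp: disjoint_iff)
        moreover then have "d \<in> D"
          using d m M I by (auto simp: lower_labels_def)
        ultimately show ?thesis
          using r by auto
      qed (use r in auto)
    qed
    ultimately have "big_top_cell n p S"
      using a b by (simp add: big_top_cell_iff min max)
    moreover have "intermediate S = I"
      unfolding intermediate_def min max using r ab by auto
    ultimately show "big_top_cell n p S \<and> intermediate S = I" ..
  qed
qed

text \<open>An edge from \<open>a\<close> to an up label is not on the lower hull, and its factor
  \<open>\<bar>A\<bar> + 1 = n + 2 - \<bar>B\<bar>\<close> is a difference of left ranks by \<open>mass_up\<close>. If the label is down, then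
  it is the only down label by which the two left ranks differ, and their difference is \<open>- 1\<close>. The
  right end is symmetric.\<close>

lemma cell_weight_eq:
  assumes I: "I \<noteq> {}" "I \<subseteq> {1..n + 1}"
    and a: "a \<in> lower_labels" "a < Min I" "lower_labels \<inter> {a<..<Min I} = {}"
    and b: "b \<in> lower_labels" "Max I < b" "lower_labels \<inter> {Max I<..<b} = {}"
    and cell: "big_top_cell n p (insert a (insert b I))"
  shows "real_of_int (cell_weight n p (insert a (insert b I))) =
    (- 1) ^ card (I \<inter> U) * (left_rank (Min I) - left_rank a) * (right_rank (Max I) - right_rank b)"
proof -
  let ?S = "insert a (insert b I)" and ?m = "Min I" and ?M = "Max I"
  have fin: "finite I"
    using I(2) by (rule finite_subset) simp
  then have m: "?m \<in> I" and M: "?M \<in> I" and bounds: "\<And>k. k \<in> I \<Longrightarrow> ?m \<le> k \<and> k \<le> ?M"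
    using I by auto
  have ab: "a < b" "a \<notin> I" "b \<notin> I"
    using a b bounds m by force+
  have "Min ?S = a"
    using a b bounds m fin by (intro Min_eqI) fastforce+
  moreover have "Max ?S = b"
    using a b bounds m fin by (intro Max_eqI) fastforce+
  moreover have "?S - {a} = insert b I" "?S - {b} = insert a I"
    using ab by auto
  moreover have "Min (insert b I) = ?m"
    using b bounds m fin by (intro Min_eqI) fastforce+
  moreover have "Max (insert a I) = ?M"
    using a bounds m M fin by (intro Max_eqI) fastforce+
  ultimately have factors: "left_factor n p ?S = edge_factor n p ?S a ?m"
    "right_factor n p ?S = edge_factor n p ?S ?M b"
    by (simp_all add: left_factor_def right_factor_def)
  have mn: "?m \<in> {1..n + 1}" "?M \<in> {1..n + 1}"
    using I m M by auto
  have bn: "b \<le> n + 2"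
    using b lower_labels_bound by blast
  have edge: "real_of_int (edge_factor n p ?S i j) =
      (if i \<in> lower_labels \<and> j \<in> lower_labels then - 1 else n + 2 - (left_rank i + right_rank j))"
    if "i \<in> ?S" "j \<in> ?S" "i < j" "j \<le> n + 2" "lower_labels \<inter> {i<..<j} = {}" for i j
  proof -
    have "card (A_set n p i j) = n + 1 - card (below i j)"
      unfolding A_set_eq[OF that(3,4)] using card_Diff_subset[OF finite_below below_sub] by simp
    moreover have "card (below i j) \<le> n + 1"
      using card_mono[OF _ below_sub] by simp
    ultimately have "real (card (A_set n p i j)) = n + 1 - (left_rank i + right_rank j)"
      using card_below[OF that(3,4)] by (simp add: of_nat_diff)
    then show ?thesis
      unfolding edge_factor_def lower_hull_edge_iff[OF cell that(1-3,5)] by simp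
  qed
  have down_a: "a \<notin> U" "b \<notin> U"
    using a b lower_labels_not_up by auto
  have "real_of_int (left_factor n p ?S) = left_rank ?m - left_rank a"
  proof (cases "?m \<in> U")
    case True
    then have "left_rank ?m = n + 2 - right_rank ?m"
      using mass_up[OF True, of "\<lambda>_. 1"] by simp
    then show ?thesis
      unfolding factors using edge[of a ?m] a mn m True lower_labels_not_up by auto
  next
    case False
    then have mD: "?m \<in> D"
      using up_or_down[OF mn(1)] by blast
    have "x \<le> a" if "x \<in> D" "x < ?m" for x
      using a(3) that by (force simp: lower_labels_def)
    then have "D \<inter> {..?m} = insert ?m (D \<inter> {..a})"
      using mD a(2) by (fastforce simp: le_less)
    then have "card (D \<inter> {..?m}) = Suc (card (D \<inter> {..a}))"
      using a(2) finite_UD by simp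
    then have "left_rank ?m - left_rank a = - 1"
      using False down_a by (simp add: left_mass_def)
    then show ?thesis
      unfolding factors using edge[of a ?m] a mn m mD by (auto simp: lower_labels_def)
  qed
  moreover have "real_of_int (right_factor n p ?S) = right_rank ?M - right_rank b"
  proof (cases "?M \<in> U")
    case True
    then have "right_rank ?M = n + 2 - left_rank ?M"
      using mass_up[OF True, of "\<lambda>_. 1"] by simp
    then show ?thesis
      unfolding factors using edge[of ?M b] b bn M True lower_labels_not_up by auto
  next
    case False
    then have MD: "?M \<in> D"
      using up_or_down[OF mn(2)] by blast
    have "b \<le> x" if "x \<in> D" "?M < x" for x
      using b(3) that by (force simp: lower_labels_def)
    then have "D \<inter> {..<b} = insert ?M (D \<inter> {..<?M})"
      using MD b(2) by (fastforce simp: le_less)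
    then have "card (D \<inter> {..<b}) = Suc (card (D \<inter> {..<?M}))"
      using finite_UD by simp
    then have "right_rank ?M - right_rank b = - 1"
      using False down_a by (simp add: right_mass_def)
    then show ?thesis
      unfolding factors using edge[of ?M b] b bn M MD by (auto simp: lower_labels_def)
  qed
  moreover have "?S \<inter> U = I \<inter> U"
    using down_a by auto
  ultimately show ?thesis
    by (simp add: cell_weight_def)
qed

lemma lower_neighbours:
  assumes "I \<noteq> {}" "I \<subseteq> {1..n + 1}"
  obtains a b where "a \<in> lower_labels" "a < Min I" "lower_labels \<inter> {a<..<Min I} = {}"
    "b \<in> lower_labels" "Max I < b" "lower_labels \<inter> {Max I<..<b} = {}"
proof -
  have fin: "finite I"
    using assms(2) by (rule finite_subset) simp
  then have mn: "1 \<le> Min I" "Max I \<le> n + 1"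
    using assms Min_in[OF fin] Max_in[OF fin] by auto
  let ?A = "{i \<in> lower_labels. i < Min I}" and ?B = "{j \<in> lower_labels. Max I < j}"
  have A: "finite ?A" "?A \<noteq> {}" and B: "finite ?B" "?B \<noteq> {}"
    using finite_lower_labels end_lower_labels mn by force+
  show ?thesis
  proof (rule that)
    show "Max ?A \<in> lower_labels" "Max ?A < Min I"
      using Max_in[OF A] by auto
    show "Min ?B \<in> lower_labels" "Max I < Min ?B"
      using Min_in[OF B] by auto
    have "x \<le> Max ?A" if "x \<in> lower_labels" "x < Min I" for x
      using that A(1) by (intro Max_ge) auto
    then show "lower_labels \<inter> {Max ?A<..<Min I} = {}"
      by (meson disjoint_iff greaterThanLessThan_iff linorder_not_le)
    have "Min ?B \<le> x" if "x \<in> lower_labels" "Max I < x" for x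
      using that B(1) by (intro Min_le) auto
    then show "lower_labels \<inter> {Max I<..<Min ?B} = {}"
      by (meson disjoint_iff greaterThanLessThan_iff linorder_not_le)
  qed
qed

lemma moebius_path_rhs_big_top:
  assumes "I \<noteq> {}" "I \<subseteq> {1..n + 1}"
  shows "(\<Sum>J | J \<noteq> {} \<and> J \<subseteq> I. (- 1) ^ card (I - J) * path_rhs J) =
    (if \<not> big_top n p I then 0
     else if \<exists>u\<in>U. I = {u} then real_of_int (big_top_weight n p I) + real n + 2
     else real_of_int (big_top_weight n p I))"
proof -
  obtain a b where ab: "a \<in> lower_labels" "a < Min I" "lower_labels \<inter> {a<..<Min I} = {}"
    "b \<in> lower_labels" "Max I < b" "lower_labels \<inter> {Max I<..<b} = {}"
    using lower_neighbours[OF assms] by blast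
  note cells = big_top_cell_with_intermediate_iff[OF assms ab]
  note moebius = moebius_path_rhs_value[OF assms ab]
  show ?thesis
  proof (cases "D \<inter> {Min I..Max I} \<subseteq> I")
    case False
    then have "\<not> big_top n p I"
      using cells by (auto simp: big_top_def)
    then show ?thesis
      unfolding moebius using False by simp
  next
    case True
    let ?S = "insert a (insert b I)"
    have S: "big_top_cell n p S \<and> intermediate S = I \<longleftrightarrow> S = ?S" for S
      using cells True by blast
    have cell: "big_top_cell n p ?S" "big_top n p I"
      using S by (auto simp: big_top_def)
    have "big_top_cell_of n p I = ?S"
      unfolding big_top_cell_of_def S by simp
    then have "real_of_int (big_top_weight n p I) =
        (- 1) ^ card (I \<inter> U) * (left_rank (Min I) - left_rank a) * (right_rank (Max I) - right_rank b)"
      unfolding big_top_weight_def using cell_weight_eq[OF assms ab cell(1)] by simp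
    then show ?thesis
      unfolding moebius using True cell(2) by simp
  qed
qed

end

section \<open>The dilation factors\<close>

theorem theorem27:
  fixes n :: nat and p :: "nat \<Rightarrow> real \<times> real" and I :: "nat set"
  assumes "n \<ge> 1"
    and "convex_polygon n p"
    and "I \<noteq> {}" and "I \<subseteq> {1..n + 1}"
  shows "(\<forall>y. minkowski_decomposition n (asso n p) y \<longrightarrow> y I = dilation_factor (asso n p) I) \<and>
    dilation_factor (asso n p) I =
      (if \<not> big_top n p I then 0
       else if \<exists>u\<in>up_labels n p. I = {u} then real_of_int (big_top_weight n p I) + real n + 2
       else real_of_int (big_top_weight n p I))"
proof -
  interpret labelled_polygon n p
    by standard (rule assms(2))
  show ?thesis
    using minkowski_decomposition_unique[OF _ assms(3,4)] moebius_path_rhs_big_top[OF assms(3,4)]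
    unfolding dilation_factor_asso[OF assms(4)] by blast
qed

end
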